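(* Let $G=(V,E,w)$ be an $n$-vertex weighted undirected graph with polynomial aspect ratio, let $h,k\in\mathbb{N}$ with $h,k\ge1$, and let $r\in V$. Then there is a path-tree one-to-many embedding $f$ of $G$ into a tree $T$ with hop-bound $O(k\cdot\log n\cdot\log\log n)\cdot h$, with $|f(V)|\le(2n)^{1+\frac1k}$ and $|f(r)|=1$, such that for every connected $h$-respecting subgraph $H$ of $G$ there is a connected subgraph $H'$ of $T$ such that for every $u\in V(H)$, $H'$ contains some vertex from $f(u)$, and $w_T(H')\le O(k\cdot\log n\cdot\log\log n)\cdot w(H)$.
   Context: Graphs are undirected with finite positive edge weights (only the output tree $T$ may have edges of weight $\infty$). $d_G^{(h)}(u,v)$ is the minimum weight of a $u$-$v$ path in $G$ with at most $h$ edges ($\infty$ if none); $\mathrm{hop}(P)$ is the number of edges of a path $P$. $w(H)$, $w_T(H')$ denote total edge weight. A subgraph $H$ of $G$ is $h$-respecting if $d_G^{(h)}(u,v)\le d_H(u,v)$ for all $u,v\in V(H)$, where $d_H$ is the shortest path distance in $H$. The aspect ratio of $G$ is $\max_{e}w(e)/\min_{e}w(e)$; "polynomial" means at most $n^c$ for a fixed constant $c$ (constants in $O(\cdot)$ may depend on $c$; (iterated) logarithmic factors inside $O(\cdot)$ are understood to be at least $1$). A one-to-many embedding $f:V\to2^{V(T)}$ sends each vertex to a non-empty set of copies, the sets $f(v)$ being pairwise disjoint; $f(A)=\bigcup_{v\in A}f(v)$. It is dominating if $d_G(u,v)\le d_T(u',v')$ for all $u'\in f(u),v'\in f(v)$.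 A path-tree one-to-many embedding of $G$ consists of a dominating one-to-many embedding $f$ into a tree $T$ with $f(V)=V(T)$, together with, for every edge $e=\{u',v'\}\in E(T)$ with $u'\in f(u),v'\in f(v)$, an associated path $P_e^T$ in $G$ from $u$ to $v$ of weight at most $w_T(e)$. Edges of weight $\infty$ represent disconnection: they carry no associated path, and two vertices of $T$ are called connected in $T$ if the $T$-path between them uses only finite-weight edges. For $u',v'$ connected in $T$ by the simple path $e_1,\dots,e_s$, $P^T_{u'v'}=P^T_{e_1}\circ\cdots\circ P^T_{e_s}$ is the concatenation (not necessarily simple). $f$ has hop-bound $\beta$ if $\mathrm{hop}(P^T_{u'v'})\le\beta$ for all $u',v'\in V(T)$ connected in $T$. *)

theory Defs
  imports
    Complex_Main
    "HOL-Library.Extended_Nonnegative_Real"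
    "HOL-Library.Disjoint_Sets"
begin

section \<open>Weighted undirected graphs\<close>

record 'v wgraph =
  verts :: "'v set"
  edges :: "'v set set"
  weight :: "'v set \<Rightarrow> ennreal"

text \<open>Finite simple graphs with positive edge weights. The weight \<open>\<infinity>\<close> is allowed here,
  since trees may use it; ordinary graphs satisfy \<open>finite_weights\<close> in addition.\<close>

definition weighted_graph :: "'v wgraph \<Rightarrow> bool" where
  "weighted_graph G \<longleftrightarrow> finite (verts G) \<and>
     (\<forall>e\<in>edges G. e \<subseteq> verts G \<and> card e = 2 \<and> 0 < weight G e)"

definition finite_weights :: "'v wgraph \<Rightarrow> bool" where
  "finite_weights G \<longleftrightarrow> (\<forall>e\<in>edges G. weight G e < \<infinity>)"

definition total_weight :: "'v wgraph \<Rightarrow> ennreal" where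
  "total_weight G = (\<Sum>e\<in>edges G. weight G e)"

text \<open>Meaningful only for graphs with at least one edge.\<close>

definition aspect_ratio :: "'v wgraph \<Rightarrow> ennreal" where
  "aspect_ratio G = Max (weight G ` edges G) / Min (weight G ` edges G)"

definition subgraph :: "'v wgraph \<Rightarrow> 'v wgraph \<Rightarrow> bool" where
  "subgraph H G \<longleftrightarrow> weighted_graph H \<and> verts H \<subseteq> verts G \<and> edges H \<subseteq> edges G \<and>
     (\<forall>e\<in>edges H. weight H e = weight G e)"

section \<open>Paths and distances\<close>

text \<open>Walks are given by their non-empty vertex lists.\<close>

definition is_walk :: "'v wgraph \<Rightarrow> 'v list \<Rightarrow> bool" where
  "is_walk G p \<longleftrightarrow> p \<noteq> [] \<and> set p \<subseteq> verts G \<and> successively (\<lambda>x y. {x, y} \<in> edges G) p"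

definition path_betw :: "'v wgraph \<Rightarrow> 'v \<Rightarrow> 'v list \<Rightarrow> 'v \<Rightarrow> bool" where
  "path_betw G u p v \<longleftrightarrow> is_walk G p \<and> distinct p \<and> hd p = u \<and> last p = v"

definition walk_edges :: "'v list \<Rightarrow> 'v set list" where
  "walk_edges p = map2 (\<lambda>x y. {x, y}) p (tl p)"

definition walk_weight :: "'v wgraph \<Rightarrow> 'v list \<Rightarrow> ennreal" where
  "walk_weight G p = sum_list (map (weight G) (walk_edges p))"

definition hop :: "'v list \<Rightarrow> nat" where
  "hop p = length (walk_edges p)"

text \<open>The infimum over the empty set is \<open>\<infinity>\<close>; otherwise the infima below are minima, as a
  finite graph has only finitely many paths.\<close>

definition hop_dist :: "'v wgraph \<Rightarrow> nat \<Rightarrow> 'v \<Rightarrow> 'v \<Rightarrow> ennreal" where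
  "hop_dist G h u v = (INF p\<in>{p. path_betw G u p v \<and> hop p \<le> h}. walk_weight G p)"

definition graph_dist :: "'v wgraph \<Rightarrow> 'v \<Rightarrow> 'v \<Rightarrow> ennreal" where
  "graph_dist G u v = (INF p\<in>{p. path_betw G u p v}. walk_weight G p)"

definition h_respecting :: "nat \<Rightarrow> 'v wgraph \<Rightarrow> 'v wgraph \<Rightarrow> bool" where
  "h_respecting h G H \<longleftrightarrow>
     (\<forall>u\<in>verts H. \<forall>v\<in>verts H. hop_dist G h u v \<le> graph_dist H u v)"

definition connected_graph :: "'v wgraph \<Rightarrow> bool" where
  "connected_graph G \<longleftrightarrow> verts G \<noteq> {} \<and>
     (\<forall>u\<in>verts G. \<forall>v\<in>verts G. \<exists>p. path_betw G u p v)"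

definition is_cycle :: "'v wgraph \<Rightarrow> 'v list \<Rightarrow> bool" where
  "is_cycle G p \<longleftrightarrow> is_walk G p \<and> distinct p \<and> length p \<ge> 3 \<and> {last p, hd p} \<in> edges G"

definition is_tree :: "'v wgraph \<Rightarrow> bool" where
  "is_tree T \<longleftrightarrow> weighted_graph T \<and> connected_graph T \<and> (\<nexists>p. is_cycle T p)"

section \<open>Path-tree one-to-many embeddings\<close>

definition one_to_many_embedding :: "'a wgraph \<Rightarrow> 'b wgraph \<Rightarrow> ('a \<Rightarrow> 'b set) \<Rightarrow> bool" where
  "one_to_many_embedding G T f \<longleftrightarrow>
     (\<forall>v\<in>verts G. f v \<noteq> {} \<and> f v \<subseteq> verts T) \<and> disjoint_family_on f (verts G)"

definition dominating :: "'a wgraph \<Rightarrow> 'b wgraph \<Rightarrow> ('a \<Rightarrow> 'b set) \<Rightarrow> bool" where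
  "dominating G T f \<longleftrightarrow> (\<forall>u\<in>verts G. \<forall>v\<in>verts G. \<forall>u'\<in>f u. \<forall>v'\<in>f v.
     graph_dist G u v \<le> graph_dist T u' v')"

text \<open>The path associated with a finite-weight edge \<open>{u', v'}\<close> of \<open>T\<close> is \<open>P u' v'\<close> when read
  from \<open>u'\<close> to \<open>v'\<close> and its reversal \<open>P v' u'\<close> when read from \<open>v'\<close> to \<open>u'\<close>. The values of
  \<open>P\<close> on all other pairs are irrelevant.\<close>

definition associated_paths ::
    "'a wgraph \<Rightarrow> 'b wgraph \<Rightarrow> ('a \<Rightarrow> 'b set) \<Rightarrow> ('b \<Rightarrow> 'b \<Rightarrow> 'a list) \<Rightarrow> bool" where
  "associated_paths G T f P \<longleftrightarrow> (\<forall>u\<in>verts G. \<forall>v\<in>verts G. \<forall>u'\<in>f u. \<forall>v'\<in>f v.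
     {u', v'} \<in> edges T \<and> weight T {u', v'} < \<infinity> \<longrightarrow>
       path_betw G u (P u' v') v \<and>
       walk_weight G (P u' v') \<le> weight T {u', v'} \<and>
       P v' u' = rev (P u' v'))"

definition path_tree_embedding ::
    "'a wgraph \<Rightarrow> 'b wgraph \<Rightarrow> ('a \<Rightarrow> 'b set) \<Rightarrow> ('b \<Rightarrow> 'b \<Rightarrow> 'a list) \<Rightarrow> bool" where
  "path_tree_embedding G T f P \<longleftrightarrow>
     is_tree T \<and> one_to_many_embedding G T f \<and> \<Union> (f ` verts G) = verts T \<and>
     dominating G T f \<and> associated_paths G T f P"

text \<open>Consecutive associated paths share an endpoint, which is kept only once. A tree path without
  edges yields the empty list, which like a one-vertex path has no edges.\<close>

fun path_concat :: "('b \<Rightarrow> 'b \<Rightarrow> 'a list) \<Rightarrow> 'b list \<Rightarrow> 'a list" where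
  "path_concat P (x # y # q) = P x y @ tl (path_concat P (y # q))"
| "path_concat P _ = []"

text \<open>The path \<open>q\<close> below is the unique simple path between its endpoints in the tree \<open>T\<close>.\<close>

definition has_hop_bound :: "'b wgraph \<Rightarrow> ('b \<Rightarrow> 'b \<Rightarrow> 'a list) \<Rightarrow> real \<Rightarrow> bool" where
  "has_hop_bound T P \<beta> \<longleftrightarrow> (\<forall>u'\<in>verts T. \<forall>v'\<in>verts T. \<forall>q.
     path_betw T u' q v' \<and> (\<forall>e\<in>set (walk_edges q). weight T e < \<infinity>) \<longrightarrow>
       real (hop (path_concat P q)) \<le> \<beta>)"

text \<open>The expression \<open>k log n log log n\<close> with both logarithmic factors taken to be at least 1.\<close>

definition k_log_loglog :: "nat \<Rightarrow> nat \<Rightarrow> real" where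
  "k_log_loglog k n = real k * max 1 (log 2 (real n)) * max 1 (log 2 (log 2 (real n)))"

end

theory Submission
  imports Defs
begin

text \<open>The tree comes from a hierarchical decomposition with geometrically decreasing scales. At
  scale \<open>w\<close> a cluster \<open>X\<close> is cut by hop-constrained balls \<open>S\<^sub>j\<close> of radius \<open>j w\<close> and \<open>j h\<close> hops: it
  is replaced by the overlapping parts \<open>X \<inter> S\<^bsub>j+2\<^esub>\<close>, which goes to the next scale, and \<open>X - S\<^sub>j\<close>.
  Among \<open>O(k log log n)\<close> radii there is one for which the \<open>(1 + 1/k)\<close>-th powers of the sizes of the
  two parts sum to at most that of \<open>X\<close>, so at most \<open>n\<^bsup>1+1/k\<^esup>\<close> singletons remain.

  An \<open>h\<close>-respecting subgraph \<open>H\<close> that meets both sides of the ring must cross it, and can be split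
  inside the ring so that all resulting pieces have incident edges of weight at least \<open>w\<close>. This
  pays for the tree edge of weight \<open>O(k log log n) w\<close> between the two parts. As the vertex sets of
  the pieces are disjoint, every scale costs \<open>O(k log log n) w(H)\<close>; there are \<open>O(log n)\<close> scales.\<close>

subsection \<open>Walks\<close>

lemma walk_edges_simps [simp]:
  "walk_edges [] = []" "walk_edges [x] = []"
  "walk_edges (x # y # p) = {x, y} # walk_edges (y # p)"
  by (auto simp: walk_edges_def)

lemma hop_eq: "hop p = length p - 1"
  by (simp add: hop_def walk_edges_def)

lemma walk_edges_append:
  "walk_edges (xs @ y # ys) = walk_edges (xs @ [y]) @ walk_edges (y # ys)"
  by (induction xs rule: induct_list012) auto

lemma walk_edges_rev: "walk_edges (rev p) = rev (walk_edges p)"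
proof (induction p rule: induct_list012)
  case (3 x y p)
  have "walk_edges (rev (x # y # p)) = walk_edges (rev (y # p)) @ [{y, x}]"
    using walk_edges_append[of "rev p" y "[x]"] by simp
  then show ?case using 3 by (simp add: insert_commute)
qed auto

lemma walk_edges_subset: "e \<in> set (walk_edges p) \<Longrightarrow> e \<subseteq> set p"
  by (induction p rule: induct_list012) auto

lemma distinct_walk_edges: "distinct p \<Longrightarrow> distinct (walk_edges p)"
proof (induction p rule: induct_list012)
  case (3 x y p)
  then show ?case using walk_edges_subset[of "{x, y}" "y # p"] by auto
qed auto

lemma walk_weight_simps [simp]:
  "walk_weight G [] = 0" "walk_weight G [x] = 0"
  "walk_weight G (x # y # p) = weight G {x, y} + walk_weight G (y # p)"
  by (auto simp: walk_weight_def)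

lemma walk_weight_append:
  "walk_weight G (xs @ y # ys) = walk_weight G (xs @ [y]) + walk_weight G (y # ys)"
  unfolding walk_weight_def by (subst walk_edges_append) simp

lemma walk_weight_rev: "walk_weight G (rev p) = walk_weight G p"
  by (simp add: walk_weight_def walk_edges_rev rev_map[symmetric])

lemma is_walk_simps [simp]:
  "\<not> is_walk G []" "is_walk G [x] \<longleftrightarrow> x \<in> verts G"
  "is_walk G (x # y # p) \<longleftrightarrow> x \<in> verts G \<and> {x, y} \<in> edges G \<and> is_walk G (y # p)"
  by (auto simp: is_walk_def)

lemma is_walk_rev: "is_walk G (rev p) \<longleftrightarrow> is_walk G p"
  by (simp add: is_walk_def insert_commute)

lemma is_walk_append:
  assumes "is_walk G p" "is_walk G q" "last p = hd q"
  shows "is_walk G (p @ tl q)" "hd (p @ tl q) = hd p" "last (p @ tl q) = last q"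
    "hop (p @ tl q) = hop p + hop q"
    "walk_weight G (p @ tl q) = walk_weight G p + walk_weight G q"
proof -
  obtain xs y where p: "p = xs @ [y]"
    using assms(1) by (cases p rule: rev_cases) auto
  obtain ys where q: "q = y # ys"
    using assms(2,3) p by (cases q) auto
  show "is_walk G (p @ tl q)"
    using assms(1,2) unfolding p q is_walk_def
    by (auto simp: successively_append_iff successively_Cons)
  show "hd (p @ tl q) = hd p" by (simp add: p q hd_append)
  show "last (p @ tl q) = last q" by (simp add: p q)
  show "hop (p @ tl q) = hop p + hop q" by (simp add: p q hop_eq)
  show "walk_weight G (p @ tl q) = walk_weight G p + walk_weight G q"
    using walk_weight_append[of G xs y ys] by (simp add: p q)
qed

text \<open>Loops are cut out. The inclusion of edges is recorded because later weight bounds depend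
  on which edges a path uses.\<close>

lemma walk_shortcut:
  assumes "is_walk G p"
  obtains q where "path_betw G (hd p) q (last p)" "hop q \<le> hop p"
    "walk_weight G q \<le> walk_weight G p" "set (walk_edges q) \<subseteq> set (walk_edges p)"
proof -
  have "\<exists>q. path_betw G (hd p) q (last p) \<and> length q \<le> length p \<and>
    walk_weight G q \<le> walk_weight G p \<and> set (walk_edges q) \<subseteq> set (walk_edges p)"
    using assms
  proof (induction p rule: induct_list012)
    case (2 x)
    then show ?case by (intro exI[of _ "[x]"]) (auto simp: path_betw_def)
  next
    case (3 x y p)
    then obtain q where q: "path_betw G y q (last (y # p))" "length q \<le> length (y # p)"
      "walk_weight G q \<le> walk_weight G (y # p)"
      "set (walk_edges q) \<subseteq> set (walk_edges (y # p))"
      by auto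
    show ?case
    \<comment> \<open>If the shortened path already visits \<open>x\<close>, it is restarted at that
      visit instead of being extended.\<close>
    proof (cases "x \<in> set q")
      case True
      then obtain ys zs where eq: "q = ys @ x # zs" by (meson split_list)
      have "walk_weight G (x # zs) \<le> walk_weight G q"
        unfolding eq walk_weight_append[of G ys x zs] by simp
      then have "walk_weight G (x # zs) \<le> walk_weight G (x # y # p)"
        using q(3) by (simp add: add_increasing)
      moreover have "set (walk_edges (x # zs)) \<subseteq> set (walk_edges q)"
        unfolding eq walk_edges_append[of ys x zs] by auto
      moreover have "path_betw G x (x # zs) (last (y # p))"
        using q(1) unfolding eq path_betw_def is_walk_def
        by (auto simp: successively_append_iff)
      ultimately show ?thesis
        using q by (intro exI[of _ "x # zs"]) (auto simp: eq)
    next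
      case False
      obtain z zs where z: "q = z # zs" using q(1) by (cases q) (auto simp: path_betw_def)
      then show ?thesis
        using False q 3(3) by (intro exI[of _ "x # q"]) (auto simp: path_betw_def add_left_mono)
    qed
  qed simp
  then show ?thesis using that by (auto simp: hop_eq)
qed

lemma path_betw_rev: "path_betw G u p v \<Longrightarrow> path_betw G v (rev p) u"
  by (cases "p = []") (auto simp: path_betw_def is_walk_rev hd_rev last_rev)

section \<open>Distances and connectedness through walks\<close>

lemma graph_dist_le_walk:
  assumes "is_walk G p"
  shows "graph_dist G (hd p) (last p) \<le> walk_weight G p"
proof -
  obtain q where "path_betw G (hd p) q (last p)" "walk_weight G q \<le> walk_weight G p"
    using walk_shortcut[OF assms] by blast
  then show ?thesis unfolding graph_dist_def by (auto intro: INF_lower2)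
qed

lemma graph_dist_commute: "graph_dist G u v = graph_dist G v u"
proof -
  have "graph_dist G u v \<le> graph_dist G v u" for u v
    unfolding graph_dist_def
    by (rule INF_greatest, rule INF_lower2[of "rev _"])
       (auto simp: walk_weight_rev intro: path_betw_rev)
  then show ?thesis by (simp add: order.antisym)
qed

text \<open>Any two vertices are connected through \<open>\<rho>\<close>, by reversing one of the
  two walks to it and cutting loops afterwards.\<close>

lemma connected_graphI:
  assumes "\<rho> \<in> verts G"
    and "\<And>x. x \<in> verts G \<Longrightarrow> \<exists>p. is_walk G p \<and> hd p = x \<and> last p = \<rho>"
  shows "connected_graph G"
  unfolding connected_graph_def
proof (intro conjI ballI)
  show "verts G \<noteq> {}" using assms(1) by blast
  fix u v assume "u \<in> verts G" "v \<in> verts G"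
  then obtain p q where "is_walk G p" "hd p = u" "last p = \<rho>"
    and "is_walk G q" "hd q = v" "last q = \<rho>"
    using assms(2) by metis
  moreover from this have "q \<noteq> []" by auto
  ultimately have "is_walk G (p @ tl (rev q))" "hd (p @ tl (rev q)) = u"
    "last (p @ tl (rev q)) = v"
    using is_walk_append[of G p "rev q"] by (auto simp: is_walk_rev hd_rev last_rev)
  then show "\<exists>p. path_betw G u p v" using walk_shortcut by metis
qed

subsection \<open>Trees given by parent pointers\<close>

text \<open>Every non-root vertex has a smaller parent, so the larger endpoint of an edge is the child.\<close>

definition parent_graph :: "nat set \<Rightarrow> nat \<Rightarrow> (nat \<Rightarrow> nat) \<Rightarrow> (nat \<Rightarrow> ennreal) \<Rightarrow> nat wgraph" where
  "parent_graph R \<rho> par wt =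
     \<lparr>verts = R, edges = (\<lambda>m. {m, par m}) ` (R - {\<rho>}), weight = (\<lambda>e. wt (Max e))\<rparr>"

lemma parent_graph_sel [simp]:
  "verts (parent_graph R \<rho> par wt) = R"
  "edges (parent_graph R \<rho> par wt) = (\<lambda>m. {m, par m}) ` (R - {\<rho>})"
  "weight (parent_graph R \<rho> par wt) = (\<lambda>e. wt (Max e))"
  by (auto simp: parent_graph_def)

lemma Max_parent_edge: "par m < m \<Longrightarrow> Max {m, par m} = (m :: nat)"
  by simp

text \<open>The root is a parameter, so that the same notion covers the whole tree and its connected
  pieces, whose root is their least vertex.\<close>

definition parent_closed :: "nat set \<Rightarrow> nat \<Rightarrow> (nat \<Rightarrow> nat) \<Rightarrow> bool" where
  "parent_closed R \<rho> par \<longleftrightarrow> finite R \<and> \<rho> \<in> R \<and> (\<forall>m\<in>R - {\<rho>}. par m < m \<and> par m \<in> R)"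

lemma weighted_parent_graph:
  assumes "parent_closed R \<rho> par" "\<And>m. m \<in> R - {\<rho>} \<Longrightarrow> 0 < wt m"
  shows "weighted_graph (parent_graph R \<rho> par wt)"
  unfolding weighted_graph_def
proof (intro conjI ballI)
  show "finite (verts (parent_graph R \<rho> par wt))"
    using assms by (simp add: parent_closed_def)
  fix e assume "e \<in> edges (parent_graph R \<rho> par wt)"
  then obtain m where m: "m \<in> R - {\<rho>}" "e = {m, par m}" by auto
  then have "par m < m" "par m \<in> R" using assms(1) by (auto simp: parent_closed_def)
  then show "e \<subseteq> verts (parent_graph R \<rho> par wt)" "card e = 2"
    "0 < weight (parent_graph R \<rho> par wt) e"
    using m assms(2) by auto
qed

lemma connected_parent_graph:
  assumes "parent_closed R \<rho> par"
  shows "connected_graph (parent_graph R \<rho> par wt)"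
proof (rule connected_graphI[of \<rho>])
  let ?T = "parent_graph R \<rho> par wt"
  show "\<rho> \<in> verts ?T" using assms by (simp add: parent_closed_def)
  fix x assume "x \<in> verts ?T"
  then show "\<exists>p. is_walk ?T p \<and> hd p = x \<and> last p = \<rho>"
  proof (induction x rule: less_induct)
    case (less x)
    show ?case
    proof (cases "x = \<rho>")
      case True
      then show ?thesis using less by (intro exI[of _ "[x]"]) auto
    next
      case False
      then have "par x < x" "par x \<in> R" using less(2) assms by (auto simp: parent_closed_def)
      with less(1) obtain p where p: "is_walk ?T p" "hd p = par x" "last p = \<rho>" by auto
      then obtain q where "p = par x # q" by (cases p) auto
      then show ?thesis using p less(2) False by (intro exI[of _ "x # p"]) auto
    qed
  qed
qed

text \<open>\<open>Max\<close> recovers the child from an edge, so distinct children own distinct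
  edges.\<close>

lemma total_weight_parent_graph:
  assumes "parent_closed R \<rho> par"
  shows "total_weight (parent_graph R \<rho> par wt) = (\<Sum>m\<in>R - {\<rho>}. wt m)"
proof -
  have *: "Max {m, par m} = m" if "m \<in> R - {\<rho>}" for m
    using assms that by (intro Max_parent_edge) (auto simp: parent_closed_def)
  then have "inj_on (\<lambda>m. {m, par m}) (R - {\<rho>})" by (rule inj_on_inverseI[of _ Max])
  then show ?thesis
    using * by (simp add: total_weight_def sum.reindex)
qed

lemma parent_graph_edgeD:
  assumes "parent_closed R \<rho> par" "{x, y} \<in> edges (parent_graph R \<rho> par wt)"
  shows "(par x = y \<and> x \<in> R - {\<rho>} \<and> y < x) \<or> (par y = x \<and> y \<in> R - {\<rho>} \<and> x < y)"
  using assms by (auto simp: parent_closed_def doubleton_eq_iff)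

text \<open>The largest vertex of a cycle would have both its neighbours as parent.\<close>

lemma acyclic_parent_graph:
  assumes "parent_closed R \<rho> par"
  shows "\<not> is_cycle (parent_graph R \<rho> par wt) p"
proof
  let ?T = "parent_graph R \<rho> par wt"
  assume cyc: "is_cycle ?T p"
  define l where "l = length p"
  have l3: "l \<ge> 3" and dist: "distinct p" and ne: "p \<noteq> []"
    using cyc by (auto simp: is_cycle_def l_def)
  have edge: "{p ! i, p ! ((i + 1) mod l)} \<in> edges ?T" if "i < l" for i
  proof (cases "i + 1 < l")
    case True
    have "successively (\<lambda>x y. {x, y} \<in> edges ?T) p"
      using cyc by (simp add: is_cycle_def is_walk_def)
    then show ?thesis using True by (auto simp: successively_conv_nth l_def)
  next
    case False
    then have "i = l - 1" using that by simp
    then show ?thesis using cyc l3 ne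
      by (auto simp: is_cycle_def l_def last_conv_nth hd_conv_nth)
  qed
  obtain i where i: "i < l" "\<And>j. j < l \<Longrightarrow> p ! j \<le> p ! i"
  proof -
    have "Max (set p) \<in> set p" using ne by simp
    then obtain i where "i < l" "p ! i = Max (set p)" by (auto simp: in_set_conv_nth l_def)
    then show ?thesis using that by (simp add: l_def)
  qed
  \<comment> \<open>The two cyclic neighbours of the largest vertex; they differ because
    \<open>l \<ge> 3\<close>.\<close>
  define s where "s = (i + 1) mod l"
  define t where "t = (if i = 0 then l - 1 else i - 1)"
  have st: "s < l" "t < l" "s \<noteq> t" "(t + 1) mod l = i"
    using l3 i(1) by (auto simp: s_def t_def mod_if)
  have "par (p ! i) = p ! s"
    using parent_graph_edgeD[OF assms edge[OF i(1)]] i(2)[OF st(1)] by (auto simp: s_def)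
  moreover have "par (p ! i) = p ! t"
    using parent_graph_edgeD[OF assms edge[OF st(2)]] i(2)[OF st(2)] st(4) by auto
  ultimately show False
    using dist st nth_eq_iff_index_eq[of p s t] by (simp add: l_def)
qed

text \<open>A simple path that has stepped from \<open>x\<close> to its child \<open>y\<close>
  cannot climb again, since the only parent of \<open>y\<close> is already used. Hence every further
  step adds one to the depth.\<close>

lemma descending_path:
  assumes "parent_closed R \<rho> par" "\<And>m. m \<in> R - {\<rho>} \<Longrightarrow> dep m = Suc (dep (par m))"
    and "is_walk (parent_graph R \<rho> par wt) (x # y # p)" "distinct (x # y # p)" "par y = x" "x < y"
  shows "dep (last (x # y # p)) = dep x + Suc (length p)"
  using assms(3-)
proof (induction p arbitrary: x y)
  case Nil
  then have "y \<in> R - {\<rho>}"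
    using parent_graph_edgeD[OF assms(1), of x y wt] by auto
  then show ?case using assms(2) Nil by auto
next
  case (Cons z p)
  have e: "{x, y} \<in> edges (parent_graph R \<rho> par wt)"
    "{y, z} \<in> edges (parent_graph R \<rho> par wt)"
    using Cons(2) by (simp_all del: parent_graph_sel)
  have z: "par z = y" "y < z"
    using parent_graph_edgeD[OF assms(1) e(2)] Cons(3,4) by auto
  have "is_walk (parent_graph R \<rho> par wt) (y # z # p)" "distinct (y # z # p)"
    using Cons(2,3) by (simp_all del: parent_graph_sel)
  then have "dep (last (y # z # p)) = dep y + Suc (length p)"
    using Cons(1) z by blast
  moreover have "dep y = Suc (dep x)"
    using parent_graph_edgeD[OF assms(1) e(1)] Cons(4,5) assms(2) by auto
  ultimately show ?case by simp
qed

text \<open>A simple path climbs first and then only descends, so its edges are bounded by the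
  depths of its two ends.\<close>

lemma parent_graph_path_length:
  assumes "parent_closed R \<rho> par" "\<And>m. m \<in> R - {\<rho>} \<Longrightarrow> dep m = Suc (dep (par m))"
    and "is_walk (parent_graph R \<rho> par wt) q" "distinct q"
  shows "length q \<le> Suc (dep (hd q) + dep (last q))"
  using assms(3-)
proof (induction q rule: induct_list012)
  case (3 x y q)
  have e: "{x, y} \<in> edges (parent_graph R \<rho> par wt)"
    and y: "is_walk (parent_graph R \<rho> par wt) (y # q)" "distinct (y # q)"
    using 3(3,4) by (simp_all del: parent_graph_sel)
  have IH: "length (y # q) \<le> Suc (dep y + dep (last (y # q)))"
    using 3(2)[OF y] by simp
  from parent_graph_edgeD[OF assms(1) e] show ?case
  proof
    assume "par x = y \<and> x \<in> R - {\<rho>} \<and> y < x"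
    then show ?thesis using IH assms(2)[of x] by simp
  next
    assume "par y = x \<and> y \<in> R - {\<rho>} \<and> x < y"
    then have "dep (last (x # y # q)) = dep x + Suc (length q)"
      using descending_path[where dep=dep and par=par, OF assms(1,2) 3(3,4)] by blast
    then show ?thesis by simp
  qed
qed auto

subsection \<open>Splitting a subgraph along a ring\<close>

text \<open>Counting every edge once per endpoint in \<open>P\<close> makes the weight additive in \<open>P\<close>.\<close>

definition incident_weight :: "'a wgraph \<Rightarrow> 'a set \<Rightarrow> ennreal" where
  "incident_weight H P = (\<Sum>e\<in>edges H. of_nat (card (P \<inter> e)) * weight H e)"

lemma finite_edges: "weighted_graph G \<Longrightarrow> finite (edges G)"
  unfolding weighted_graph_def by (auto intro: finite_subset[of _ "Pow (verts G)"])

lemma finite_edge: "weighted_graph G \<Longrightarrow> e \<in> edges G \<Longrightarrow> finite e"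
  unfolding weighted_graph_def by (auto intro: finite_subset)

lemma incident_weight_Un:
  assumes "weighted_graph H" "P \<inter> Q = {}"
  shows "incident_weight H (P \<union> Q) = incident_weight H P + incident_weight H Q"
proof -
  have "card ((P \<union> Q) \<inter> e) = card (P \<inter> e) + card (Q \<inter> e)" if "e \<in> edges H" for e
    using finite_edge[OF assms(1) that] assms(2)
    by (subst card_Un_disjoint[symmetric]) (auto simp: Int_Un_distrib2)
  then show ?thesis
    by (simp add: incident_weight_def sum.distrib[symmetric] distrib_right)
qed

lemma incident_weight_verts:
  assumes "weighted_graph H"
  shows "incident_weight H (verts H) = 2 * total_weight H"
proof -
  have "card (verts H \<inter> e) = 2" if "e \<in> edges H" for e
    using assms that by (auto simp: weighted_graph_def Int_absorb1)
  then show ?thesis by (simp add: incident_weight_def total_weight_def sum_distrib_left)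
qed

text \<open>A path uses each edge once, and \<open>incident_weight\<close> counts an edge meeting
  \<open>P\<close> at least once.\<close>

lemma path_weight_le_incident_weight:
  assumes "weighted_graph H" "is_walk H p" "distinct p"
    and "\<And>e. e \<in> set (walk_edges p) \<Longrightarrow> P \<inter> e \<noteq> {}"
  shows "walk_weight H p \<le> incident_weight H P"
proof -
  have sub: "set (walk_edges p) \<subseteq> edges H"
    using assms(2) by (induction p rule: induct_list012) auto
  have "walk_weight H p = (\<Sum>e\<in>set (walk_edges p). weight H e)"
    unfolding walk_weight_def using distinct_walk_edges[OF assms(3)]
    by (simp add: sum_list_distinct_conv_sum_set)
  also have "\<dots> \<le> (\<Sum>e\<in>set (walk_edges p). of_nat (card (P \<inter> e)) * weight H e)"
  proof (rule sum_mono)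
    fix e assume e: "e \<in> set (walk_edges p)"
    then have "card (P \<inter> e) \<ge> 1"
      using assms(4)[OF e] finite_edge[OF assms(1)] sub
      by (metis Suc_leI One_nat_def card_gt_0_iff finite_Int subsetD)
    then have "(1 :: ennreal) \<le> of_nat (card (P \<inter> e))"
      by (metis of_nat_1 of_nat_le_iff)
    then have "1 * weight H e \<le> of_nat (card (P \<inter> e)) * weight H e"
      by (rule mult_right_mono) simp
    then show "weight H e \<le> of_nat (card (P \<inter> e)) * weight H e" by simp
  qed
  also have "\<dots> \<le> incident_weight H P"
    unfolding incident_weight_def
    by (rule sum_mono2) (auto simp: sub finite_edges[OF assms(1)])
  finally show ?thesis .
qed

definition adj_within :: "'a wgraph \<Rightarrow> 'a set \<Rightarrow> ('a \<times> 'a) set" where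
  "adj_within H S = {(x, y). x \<in> S \<and> y \<in> S \<and> {x, y} \<in> edges H}"

text \<open>A path from \<open>o'\<close> to \<open>y\<close> inside \<open>P\<close>, prolonged by
  the edge to \<open>z\<close>, uses only edges that meet \<open>P\<close>. So a piece that reaches
  across a ring has at least the width of the ring as incident weight.\<close>

lemma graph_dist_le_incident_weight:
  assumes H: "weighted_graph H"
    and "(o', y) \<in> (adj_within H P)\<^sup>*" "o' \<in> P" "{y, z} \<in> edges H"
  shows "graph_dist H z o' \<le> incident_weight H P"
proof -
  have vert: "x \<in> verts H" "y \<in> verts H" if "{x, y} \<in> edges H" for x y
    using H that by (auto simp: weighted_graph_def)
  have "\<exists>p. is_walk H p \<and> hd p = y \<and> last p = o' \<and> set p \<subseteq> P"
    using assms(2)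
  proof (induction rule: rtrancl_induct)
    case base
    have "o' \<in> verts H"
      using assms(2,4) vert by (cases rule: converse_rtranclE) (auto simp: adj_within_def)
    then show ?case using assms(3) by (intro exI[of _ "[o']"]) auto
  next
    case (step x y)
    then obtain p where p: "is_walk H p" "hd p = x" "last p = o'" "set p \<subseteq> P" by auto
    then obtain q where "p = x # q" by (cases p) auto
    then show ?case using p step(2) vert(2)[of x y]
      by (intro exI[of _ "y # p"]) (auto simp: adj_within_def insert_commute)
  qed
  then obtain p where p: "is_walk H p" "hd p = y" "last p = o'" "set p \<subseteq> P" by auto
  then obtain q where q: "p = y # q" by (cases p) auto
  have zp: "is_walk H (z # p)" "hd (z # p) = z" "last (z # p) = o'"
    using p q assms(4) vert by (auto simp: insert_commute)
  have meets: "P \<inter> e \<noteq> {}" if "e \<in> set (walk_edges (z # p))" for e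
  proof -
    have "P \<inter> e \<noteq> {}" if "e \<in> set (walk_edges p)" for e
      using that p(4) by (induction p rule: induct_list012) auto
    then show ?thesis using that p(4) q by auto
  qed
  obtain r where r: "path_betw H z r o'" "set (walk_edges r) \<subseteq> set (walk_edges (z # p))"
    using walk_shortcut[OF zp(1)] zp by metis
  then have "is_walk H r" "distinct r" by (auto simp: path_betw_def)
  then have "walk_weight H r \<le> incident_weight H P"
    using meets r(2) by (intro path_weight_le_incident_weight[OF H]) blast+
  then show ?thesis
    using graph_dist_le_walk[of H r] r(1) by (auto simp: path_betw_def)
qed

text \<open>The invariant of the descent: a piece of \<open>H\<close> that has been separated from the rest of \<open>H\<close>
  by rings of width \<open>w\<close> can pay for them with its incident edges.\<close>

definition well_cut :: "'a wgraph \<Rightarrow> ennreal \<Rightarrow> 'a set \<Rightarrow> bool" where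
  "well_cut H w Q \<longleftrightarrow> (\<forall>P\<subseteq>Q. P \<noteq> {} \<and> (\<forall>x\<in>P. \<forall>y\<in>Q - P. {x, y} \<notin> edges H) \<longrightarrow>
     w \<le> incident_weight H P \<or> P = verts H)"

lemma well_cut_closedD:
  assumes "well_cut H w Q" "P \<subseteq> Q" "P \<noteq> {}"
    and "\<And>x y. x \<in> P \<Longrightarrow> y \<in> Q - P \<Longrightarrow> {x, y} \<notin> edges H"
  shows "w \<le> incident_weight H P \<or> P = verts H"
  using assms(1)[unfolded well_cut_def, rule_format, of P] assms(2-4) by simp

lemma well_cutD:
  "well_cut H w Q \<Longrightarrow> Q \<noteq> {} \<Longrightarrow> Q \<noteq> verts H \<Longrightarrow> w \<le> incident_weight H Q"
  by (auto simp: well_cut_def)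

lemma well_cut_mono: "well_cut H w Q \<Longrightarrow> w' \<le> w \<Longrightarrow> well_cut H w' Q"
  unfolding well_cut_def by (meson order.trans)

text \<open>The invariant holds at the start for every \<open>w\<close>: a connected graph has no
  proper non-empty part without outgoing edges.\<close>

lemma well_cut_verts:
  assumes "connected_graph H"
  shows "well_cut H w (verts H)"
  unfolding well_cut_def
proof (intro allI impI disjI2, elim conjE)
  fix P assume P: "P \<subseteq> verts H" "P \<noteq> {}"
    and closed: "\<forall>x\<in>P. \<forall>y\<in>verts H - P. {x, y} \<notin> edges H"
  have "last p \<in> P" if "is_walk H p" "hd p \<in> P" for p
    using that
  proof (induction p rule: induct_list012)
    case (3 x y p)
    then have "x \<in> P" "{x, y} \<in> edges H" "y \<in> verts H"
      by (auto simp: is_walk_def)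
    then have "y \<in> P" using closed by blast
    then show ?case using 3 by simp
  qed auto
  then have "v \<in> P" if "v \<in> verts H" for v
    using that P assms unfolding connected_graph_def path_betw_def by (metis equals0I subsetD)
  then show "P = verts H" using P by auto
qed

text \<open>The walk is traced backwards from \<open>y\<close>: each predecessor is drawn into
  \<open>P\<close> by the closure hypothesis.\<close>

lemma adj_within_closed:
  assumes "(x, y) \<in> (adj_within H S)\<^sup>*" "y \<in> P"
    and "\<And>x' z. (x, x') \<in> (adj_within H S)\<^sup>* \<Longrightarrow> (x', z) \<in> adj_within H S \<Longrightarrow> z \<in> P \<Longrightarrow> x' \<in> P"
  shows "x \<in> P \<and> (x, y) \<in> (adj_within H P)\<^sup>*"
  using assms(1,2)
proof (induction rule: rtrancl_induct)
  case (step y z)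
  then have "y \<in> P" using assms(3) by blast
  moreover from this have "(y, z) \<in> adj_within H P"
    using step(2,4) by (auto simp: adj_within_def)
  ultimately show ?case using step by auto
qed simp

text \<open>A closed part of \<open>Q1\<close> that is adjacent to \<open>Q2\<close> contains a path from \<open>A\<close> out of \<open>M\<close> (up to its
  last edge), and a closed part of \<open>Q2\<close> adjacent to \<open>Q1\<close> one from outside \<open>B\<close> into \<open>M\<close>. Cutting
  along the middle set \<open>M\<close> leaves a full ring width on either side.\<close>

lemma well_cut_split:
  assumes H: "weighted_graph H" and QH: "Q \<subseteq> verts H" and AM: "A \<subseteq> M" "M \<subseteq> B"
    and sep1: "\<And>x y. x \<in> A \<inter> verts H \<Longrightarrow> y \<in> verts H - M \<Longrightarrow> w \<le> graph_dist H x y"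
    and sep2: "\<And>x y. x \<in> M \<inter> verts H \<Longrightarrow> y \<in> verts H - B \<Longrightarrow> w \<le> graph_dist H x y"
    and Q: "well_cut H w Q"
  obtains Q1 Q2 where "Q = Q1 \<union> Q2" "Q1 \<inter> Q2 = {}" "Q1 \<subseteq> B" "Q2 \<inter> A = {}"
    "well_cut H w Q1" "well_cut H w Q2"
proof -
  \<comment> \<open>\<open>K\<close> is what \<open>A\<close> reaches inside \<open>M\<close>, and
    \<open>Out\<close> is what the outside of \<open>B\<close> reaches while avoiding
    \<open>K\<close>. The two pieces will be \<open>Q - Out\<close> and \<open>Out\<close>.\<close>
  define K where "K = {x. \<exists>a\<in>Q \<inter> A. (a, x) \<in> (adj_within H (Q \<inter> M))\<^sup>*}"
  define Out where "Out = {x. \<exists>b\<in>Q - B. (b, x) \<in> (adj_within H (Q - K))\<^sup>*}"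
  have in_adj: "y \<in> S" if "(x, y) \<in> (adj_within H S)\<^sup>*" "x \<in> S" for x y S
    using that by (induction rule: rtrancl_induct) (auto simp: adj_within_def)
  have KQM: "K \<subseteq> Q \<inter> M" using in_adj AM unfolding K_def by blast
  have AK: "Q \<inter> A \<subseteq> K" unfolding K_def by blast
  have BO: "Q - B \<subseteq> Out" unfolding Out_def by blast
  have OQK: "Out \<subseteq> Q - K"
  proof
    fix x assume "x \<in> Out"
    then obtain b where "b \<in> Q - B" "(b, x) \<in> (adj_within H (Q - K))\<^sup>*" by (auto simp: Out_def)
    moreover have "b \<in> Q - K" using \<open>b \<in> Q - B\<close> KQM AM by auto
    ultimately show "x \<in> Q - K" using in_adj by fast
  qed
  have Kstep: "z \<in> K" if "y \<in> K" "{y, z} \<in> edges H" "z \<in> Q \<inter> M" for y z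
  proof -
    have "(y, z) \<in> adj_within H (Q \<inter> M)" using that KQM by (auto simp: adj_within_def)
    then show ?thesis using that(1) unfolding K_def by (blast intro: rtrancl_into_rtrancl)
  qed
  have Ostep: "z \<in> Out" if "y \<in> Out" "{y, z} \<in> edges H" "z \<in> Q - K" for y z
  proof -
    have "(y, z) \<in> adj_within H (Q - K)" using that OQK by (auto simp: adj_within_def)
    then show ?thesis using that(1) unfolding Out_def by (blast intro: rtrancl_into_rtrancl)
  qed
  have "well_cut H w (Q - Out)"
    unfolding well_cut_def
  proof (intro allI impI, elim conjE)
    fix P assume P: "P \<subseteq> Q - Out" "P \<noteq> {}"
      and closed: "\<forall>x\<in>P. \<forall>y\<in>Q - Out - P. {x, y} \<notin> edges H"
    show "w \<le> incident_weight H P \<or> P = verts H"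
    proof (cases "\<exists>y\<in>P. \<exists>z\<in>Out. {y, z} \<in> edges H")
      \<comment> \<open>Nothing joins \<open>P\<close> to \<open>Out\<close>, so \<open>P\<close> is
        closed in all of \<open>Q\<close> and the bound is inherited from \<open>Q\<close>.\<close>
      case False
      then show ?thesis using closed P by (intro well_cut_closedD[OF Q]) blast+
    next
      case True
      then obtain y z where yz: "y \<in> P" "z \<in> Out" "{y, z} \<in> edges H" by blast
      \<comment> \<open>Outside \<open>K\<close>, the vertex \<open>y\<close> would have been
        absorbed by \<open>Out\<close>; inside \<open>M\<close>, the vertex \<open>z\<close> would
        have been absorbed by \<open>K\<close>. So a path leads from \<open>A\<close> through
        \<open>P\<close> to a vertex outside \<open>M\<close>.\<close>
      have "y \<in> K" using Ostep[of z y] yz P by (auto simp: insert_commute)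
      then obtain a where a: "a \<in> Q \<inter> A" "(a, y) \<in> (adj_within H (Q \<inter> M))\<^sup>*"
        by (auto simp: K_def)
      have "z \<notin> M" using Kstep[of y z] \<open>y \<in> K\<close> yz OQK by auto
      have "a \<in> P \<and> (a, y) \<in> (adj_within H P)\<^sup>*"
      proof (rule adj_within_closed[OF a(2) yz(1)])
        fix x' z' assume "(a, x') \<in> (adj_within H (Q \<inter> M))\<^sup>*"
          and s: "(x', z') \<in> adj_within H (Q \<inter> M)" "z' \<in> P"
        then have "x' \<in> K" using a by (auto simp: K_def)
        then have "x' \<in> Q - Out" using KQM OQK by auto
        moreover have "{z', x'} \<in> edges H"
          using s by (simp add: adj_within_def insert_commute)
        ultimately show "x' \<in> P" using closed s(2) by blast
      qed
      then have "graph_dist H z a \<le> incident_weight H P"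
        using graph_dist_le_incident_weight[OF H] yz by blast
      moreover have "w \<le> graph_dist H a z"
        using sep1[of a z] a \<open>z \<notin> M\<close> yz(2) OQK QH by auto
      ultimately show ?thesis
        unfolding graph_dist_commute[of H z a] by (blast intro: order.trans)
    qed
  qed
  moreover have "well_cut H w Out"
    unfolding well_cut_def
  proof (intro allI impI, elim conjE)
    fix P assume P: "P \<subseteq> Out" "P \<noteq> {}"
      and closed: "\<forall>x\<in>P. \<forall>y\<in>Out - P. {x, y} \<notin> edges H"
    show "w \<le> incident_weight H P \<or> P = verts H"
    proof (cases "\<exists>y\<in>P. \<exists>z\<in>Q - Out. {y, z} \<in> edges H")
      case False
      then show ?thesis using closed P OQK by (intro well_cut_closedD[OF Q]) blast+
    next
      case True
      then obtain y z where yz: "y \<in> P" "z \<in> Q - Out" "{y, z} \<in> edges H" by blast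
      \<comment> \<open>The crossing in the other direction: \<open>z\<close> lies in
        \<open>M\<close>, while the piece reaches back to some \<open>b\<close> outside
        \<open>B\<close>.\<close>
      have "z \<in> K" using Ostep[of y z] yz P by auto
      obtain b where b: "b \<in> Q - B" "(b, y) \<in> (adj_within H (Q - K))\<^sup>*"
        using yz(1) P by (auto simp: Out_def)
      have "b \<in> P \<and> (b, y) \<in> (adj_within H P)\<^sup>*"
      proof (rule adj_within_closed[OF b(2) yz(1)])
        fix x' z' assume "(b, x') \<in> (adj_within H (Q - K))\<^sup>*"
          and s: "(x', z') \<in> adj_within H (Q - K)" "z' \<in> P"
        then have "x' \<in> Out" using b by (auto simp: Out_def)
        moreover have "{z', x'} \<in> edges H"
          using s by (simp add: adj_within_def insert_commute)
        ultimately show "x' \<in> P" using closed s(2) by blast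
      qed
      then have "graph_dist H z b \<le> incident_weight H P"
        using graph_dist_le_incident_weight[OF H] yz by blast
      moreover have "w \<le> graph_dist H z b"
        using sep2[of z b] b \<open>z \<in> K\<close> KQM QH by auto
      ultimately show ?thesis by (blast intro: order.trans)
    qed
  qed
  moreover have "Q - Out \<subseteq> B" using BO by blast
  moreover have "Out \<inter> A = {}" using OQK AK by blast
  moreover have "Q = (Q - Out) \<union> Out" using OQK by blast
  ultimately show ?thesis using that[of "Q - Out" Out] by blast
qed

subsection \<open>Overlapping rings of small total size\<close>

text \<open>With \<open>a j = x j / m\<close>, failure of the conclusion at \<open>j\<close> means
  \<open>a j < a (j + 1) powr (1 + \<epsilon>)\<close> and \<open>1 - a (j + 1) < (1 - a j) powr (1 + \<epsilon>)\<close>. The first makes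
  \<open>a\<close> reach \<open>1/2\<close> after \<open>t\<close> steps, the second makes it reach \<open>1\<close> after \<open>t + 1\<close> more.\<close>

lemma ring_growth:
  fixes x :: "nat \<Rightarrow> nat" and m :: nat and \<epsilon> :: real
  assumes "0 < \<epsilon>" "1 \<le> x 0" "\<And>j. x j \<le> m" and t: "log 2 m \<le> (1 + \<epsilon>) ^ t"
  obtains j where "j \<le> 2 * t + 1"
    "real (x (Suc j)) powr (1 + \<epsilon>) + real (m - x j) powr (1 + \<epsilon>) \<le> real m powr (1 + \<epsilon>)"
proof (rule ccontr)
  note intro = that
  assume "\<not> thesis"
  define q where "q = 1 + \<epsilon>"
  have q: "1 < q" using assms by (simp add: q_def)
  have m: "1 \<le> m" using assms(2) assms(3)[of 0] by linarith
  define a where "a j = real (x j) / real m" for j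
  have a01: "0 \<le> a j" "a j \<le> 1" for j using assms(3)[of j] m by (auto simp: a_def field_simps)
  have fail: "1 < a (Suc j) powr q + (1 - a j) powr q" if "j \<le> 2 * t + 1" for j
  proof -
    have "real m powr q < real (x (Suc j)) powr q + real (m - x j) powr q"
      using that \<open>\<not> thesis\<close> intro[of j] unfolding q_def by linarith
    also have "real (x (Suc j)) = m * a (Suc j)" using m by (simp add: a_def)
    also have "real (m - x j) = m * (1 - a j)" using m assms(3)[of j]
      by (simp add: a_def of_nat_diff field_simps)
    finally have "real m powr q < real m powr q * (a (Suc j) powr q + (1 - a j) powr q)"
      using a01 m by (simp add: powr_mult distrib_left)
    then show ?thesis using m by simp
  qed
  \<comment> \<open>The exponent \<open>q > 1\<close> shrinks numbers of the unit interval. Applied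
    to one summand of \<open>fail\<close> at a time, this gives \<open>up\<close> and
    \<open>down\<close>.\<close>
  have le: "b powr q \<le> b" if "0 \<le> b" "b \<le> 1" for b :: real
    using powr_mono'[of 1 q b] that q by (cases "b = 0") auto
  have up: "a j \<le> a (Suc j) powr q" if "j \<le> 2 * t + 1" for j
    using fail[OF that] le[of "1 - a j"] a01[of j] by linarith
  have down: "1 - a (Suc j) < (1 - a j) powr q" if "j \<le> 2 * t + 1" for j
    using fail[OF that] le[of "a (Suc j)"] a01[of "Suc j"] by linarith
  have a0: "1 / m \<le> a 0" using assms(2) m by (simp add: a_def divide_right_mono)
  \<comment> \<open>The purpose of \<open>t\<close>: iterating \<open>up\<close> from a value of at
    least \<open>1 / m\<close> rules out a value below \<open>1/2\<close> after \<open>t\<close>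
    steps.\<close>
  have half: "(1/2) powr (q ^ t) \<le> 1 / m"
  proof -
    have "(1/2 :: real) powr (q ^ t) \<le> (1/2) powr (log 2 m)"
      using t by (intro powr_mono') (auto simp: q_def)
    also have "\<dots> = 1 / m" using m by (simp add: powr_divide)
    finally show ?thesis .
  qed
  have p1: "1 / m \<le> a j powr (q ^ j)" if "j \<le> 2 * t + 2" for j
    using that
  proof (induction j)
    case 0
    then show ?case using a0 a01[of 0] by simp
  next
    case (Suc j)
    then have "1 / m \<le> a j powr (q ^ j)" by simp
    also have "\<dots> \<le> (a (Suc j) powr q) powr (q ^ j)"
      using up[of j] Suc a01 q by (intro powr_mono2) auto
    finally show ?case by (simp add: powr_powr)
  qed
  have "1/2 \<le> a t"
  proof (rule ccontr)
    assume "\<not> 1/2 \<le> a t"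
    then have "a t powr (q ^ t) < (1/2) powr (q ^ t)"
      using a01 q by (intro powr_less_mono2) auto
    then show False using half p1[of t] by simp
  qed
  have p2: "1 - a (t + i) \<le> (1/2) powr (q ^ i)" if "i \<le> t" for i
    using that
  proof (induction i)
    case 0
    then show ?case using \<open>1/2 \<le> a t\<close> by simp
  next
    case (Suc i)
    have "1 - a (t + Suc i) \<le> (1 - a (t + i)) powr q" using down[of "t + i"] Suc by simp
    also have "\<dots> \<le> ((1/2) powr (q ^ i)) powr q"
      using Suc a01 q by (intro powr_mono2) auto
    finally show ?case by (simp add: powr_powr mult.commute)
  qed
  \<comment> \<open>One more strict step takes \<open>1 - a\<close> below \<open>1 / m\<close>, so
    the integer \<open>x (2 * t + 1)\<close> is \<open>m\<close>. The step after that would make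
    \<open>1 - a\<close> negative.\<close>
  have "1 - a (2 * t + 1) < (1 - a (2 * t)) powr q" using down[of "2 * t"] by simp
  also have "\<dots> \<le> 1 - a (2 * t)" using le a01[of "2 * t"] by auto
  also have "\<dots> \<le> 1 / m" using p2[of t] half by (simp add: mult_2)
  finally have "real m * (1 - a (2 * t + 1)) < real m * (1 / m)"
    using m by (intro mult_strict_left_mono) auto
  then have "real m < real (x (2 * t + 1)) + 1"
    using m by (simp add: a_def right_diff_distrib)
  then have "x (2 * t + 1) = m" using assms(3)[of "2 * t + 1"] by linarith
  then have "1 - a (Suc (2 * t + 1)) < 0" using down[of "2 * t + 1"] m by (simp add: a_def)
  then show False using a01[of "Suc (2 * t + 1)"] by simp
qed

subsection \<open>Cluster trees\<close>

text \<open>\<open>Join s d t\<close> attaches the root of \<open>t\<close> to the root of \<open>s\<close> by an edge of weight \<open>d\<close>. The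
  leaves, numbered from left to right, become the vertices of the embedding tree; the root of a
  cluster tree is its leftmost leaf.\<close>

datatype 'a ctree = Leaf 'a | Join "'a ctree" ennreal "'a ctree"

primrec leaves :: "'a ctree \<Rightarrow> 'a list" where
  "leaves (Leaf v) = [v]"
| "leaves (Join s d t) = leaves s @ leaves t"

primrec par :: "'a ctree \<Rightarrow> nat \<Rightarrow> nat" where
  "par (Leaf v) m = 0"
| "par (Join s d t) m = (let n = length (leaves s) in
     if m < n then par s m else if m = n then 0 else n + par t (m - n))"

primrec wt :: "'a ctree \<Rightarrow> nat \<Rightarrow> ennreal" where
  "wt (Leaf v) m = 0"
| "wt (Join s d t) m = (let n = length (leaves s) in
     if m < n then wt s m else if m = n then d else wt t (m - n))"

primrec dep :: "'a ctree \<Rightarrow> nat \<Rightarrow> nat" where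
  "dep (Leaf v) m = 0"
| "dep (Join s d t) m = (let n = length (leaves s) in
     if m < n then dep s m else Suc (dep t (m - n)))"

lemma leaves_nonempty [simp]: "leaves t \<noteq> []"
  by (induction t) auto

lemma par_less: "0 < m \<Longrightarrow> m < length (leaves t) \<Longrightarrow> par t m < m"
proof (induction t arbitrary: m)
  case (Join s d t)
  let ?n = "length (leaves s)"
  consider "m < ?n" | "m = ?n" | "?n < m" by linarith
  then show ?case
  proof cases
    case 3
    then have "par t (m - ?n) < m - ?n" using Join(2)[of "m - ?n"] Join(4) by simp
    then show ?thesis using 3 by (simp add: Let_def)
  qed (use Join in \<open>simp_all add: Let_def\<close>)
qed simp

lemma dep_root [simp]: "dep t 0 = 0"
  by (induction t) auto

lemma dep_par: "0 < m \<Longrightarrow> m < length (leaves t) \<Longrightarrow> dep t m = Suc (dep t (par t m))"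
proof (induction t arbitrary: m)
  case (Join s d t)
  let ?n = "length (leaves s)"
  consider "m < ?n" | "m = ?n" | "?n < m" by linarith
  then show ?case
  proof cases
    case 1
    then show ?thesis using Join par_less[of m s] by (simp add: Let_def)
  next
    case 3
    then show ?thesis using Join(2)[of "m - ?n"] Join(4) by (simp add: Let_def)
  qed (simp add: Let_def)
qed simp

text \<open>A piece lying entirely inside an attached tree has a positive root and does not pay for
  the edge that attaches it.\<close>

definition subtree :: "'a ctree \<Rightarrow> nat set \<Rightarrow> nat \<Rightarrow> bool" where
  "subtree t R \<rho> \<longleftrightarrow> parent_closed R \<rho> (par t) \<and> R \<subseteq> {..<length (leaves t)}"

lemma subtree_root: "subtree t {0} 0"
  by (simp add: subtree_def parent_closed_def)

lemma subtree_Join_left: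
  assumes "subtree s R \<rho>"
  shows "subtree (Join s d t) R \<rho>"
    "(\<Sum>m\<in>R - {\<rho>}. wt (Join s d t) m) = (\<Sum>m\<in>R - {\<rho>}. wt s m)"
    "(!) (leaves (Join s d t)) ` R = (!) (leaves s) ` R"
proof -
  have R: "m < length (leaves s)" if "m \<in> R" for m using assms that by (auto simp: subtree_def)
  show "subtree (Join s d t) R \<rho>"
    using assms R by (auto simp: subtree_def parent_closed_def Let_def trans_less_add1)
  show "(\<Sum>m\<in>R - {\<rho>}. wt (Join s d t) m) = (\<Sum>m\<in>R - {\<rho>}. wt s m)"
    using R by (intro sum.cong) (auto simp: Let_def)
  show "(!) (leaves (Join s d t)) ` R = (!) (leaves s) ` R"
    using R by (intro image_cong) (auto simp: nth_append)
qed

text \<open>Apart from the shift by \<open>n\<close>, joining changes the parent only of the root of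
  \<open>t\<close>. Every vertex of \<open>R - {\<rho>}\<close> is positive, hence
  unaffected.\<close>

lemma subtree_Join_right:
  fixes s t :: "'a ctree"
  assumes "subtree t R \<rho>"
  defines "n \<equiv> length (leaves s)"
  shows "subtree (Join s d t) ((+) n ` R) (n + \<rho>)"
    "(\<Sum>m\<in>(+) n ` R - {n + \<rho>}. wt (Join s d t) m) = (\<Sum>m\<in>R - {\<rho>}. wt t m)"
    "(!) (leaves (Join s d t)) ` (+) n ` R = (!) (leaves t) ` R"
proof -
  have pos: "0 < m" if "m \<in> R - {\<rho>}" for m
    using assms that by (auto simp: subtree_def parent_closed_def)
  have eq: "(+) n ` R - {n + \<rho>} = (+) n ` (R - {\<rho>})" by auto
  have par: "par (Join s d t) (n + m) = n + par t m" and
    wt: "wt (Join s d t) (n + m) = wt t m" if "m \<in> R - {\<rho>}" for m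
    using pos[OF that] by (simp_all add: n_def)
  show "subtree (Join s d t) ((+) n ` R) (n + \<rho>)"
    unfolding subtree_def parent_closed_def eq
  proof (intro conjI ballI)
    fix m assume "m \<in> (+) n ` (R - {\<rho>})"
    then obtain m' where m': "m = n + m'" "m' \<in> R - {\<rho>}" by blast
    then have "par t m' < m'" "par t m' \<in> R"
      using assms(1) by (auto simp: subtree_def parent_closed_def)
    then show "par (Join s d t) m < m" "par (Join s d t) m \<in> (+) n ` R"
      unfolding m'(1) par[OF m'(2)] by auto
  qed (use assms(1) in \<open>auto simp: subtree_def parent_closed_def n_def\<close>)
  show "(\<Sum>m\<in>(+) n ` R - {n + \<rho>}. wt (Join s d t) m) = (\<Sum>m\<in>R - {\<rho>}. wt t m)"
    unfolding eq by (subst sum.reindex) (simp_all add: wt del: wt.simps)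
  show "(!) (leaves (Join s d t)) ` (+) n ` R = (!) (leaves t) ` R"
    by (force simp: n_def nth_append image_image)
qed

text \<open>Both pieces contain the root of their tree, so the joining edge, owned by leaf
  \<open>n\<close>, connects them. This is the only place where \<open>d\<close> is charged.\<close>

lemma subtree_Join_both:
  fixes s t :: "'a ctree"
  assumes R: "subtree s R 0" and S: "subtree t S 0"
  defines "n \<equiv> length (leaves s)"
  shows "subtree (Join s d t) (R \<union> (+) n ` S) 0"
    "(\<Sum>m\<in>R \<union> (+) n ` S - {0}. wt (Join s d t) m) =
       (\<Sum>m\<in>R - {0}. wt s m) + (d + (\<Sum>m\<in>S - {0}. wt t m))"
    "(!) (leaves (Join s d t)) ` (R \<union> (+) n ` S) = (!) (leaves s) ` R \<union> (!) (leaves t) ` S"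
proof -
  note left = subtree_Join_left[OF R, of d t]
  note right = subtree_Join_right[OF S, of s d, folded n_def]
  have n: "0 < n" by (simp add: n_def)
  have fin: "finite R" "finite S" and z: "0 \<in> R" "0 \<in> S"
    using R S by (auto simp: subtree_def parent_closed_def)
  have Rn: "R \<subseteq> {..<n}" using R by (simp add: subtree_def n_def)
  have parn: "par (Join s d t) n = 0" and wtn: "wt (Join s d t) n = d"
    by (simp_all add: n_def)
  show "subtree (Join s d t) (R \<union> (+) n ` S) 0"
    unfolding subtree_def parent_closed_def
  proof (intro conjI ballI)
    fix m assume m: "m \<in> R \<union> (+) n ` S - {0}"
    consider "m \<in> R - {0}" | "m = n" | "m \<in> (+) n ` S - {n + 0}" using m by auto
    then have "par (Join s d t) m < m \<and> par (Join s d t) m \<in> R \<union> (+) n ` S"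
    proof cases
      case 1
      then show ?thesis using left(1) by (auto simp: subtree_def parent_closed_def simp del: par.simps)
    next
      case 2
      then show ?thesis using parn n z by simp
    next
      case 3
      then show ?thesis using right(1) unfolding subtree_def parent_closed_def by blast
    qed
    then show "par (Join s d t) m < m" "par (Join s d t) m \<in> R \<union> (+) n ` S" by auto
  qed (use fin z left(1) right(1) in \<open>auto simp: subtree_def\<close>)
  define U where "U = (+) n ` S - {n + 0}"
  have "R \<union> (+) n ` S - {0} = (R - {0}) \<union> insert n U"
    using n z by (auto simp: U_def)
  moreover have "(R - {0}) \<inter> insert n U = {}" using Rn by (auto simp: U_def)
  moreover have "n \<notin> U" "finite U" using fin by (auto simp: U_def)
  ultimately have "(\<Sum>m\<in>R \<union> (+) n ` S - {0}. wt (Join s d t) m) =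
      (\<Sum>m\<in>R - {0}. wt (Join s d t) m) + (wt (Join s d t) n + (\<Sum>m\<in>U. wt (Join s d t) m))"
    using fin by (simp add: sum.union_disjoint del: wt.simps)
  then show "(\<Sum>m\<in>R \<union> (+) n ` S - {0}. wt (Join s d t) m) =
      (\<Sum>m\<in>R - {0}. wt s m) + (d + (\<Sum>m\<in>S - {0}. wt t m))"
    unfolding left(2) U_def right(2) wtn .
  show "(!) (leaves (Join s d t)) ` (R \<union> (+) n ` S) = (!) (leaves s) ` R \<union> (!) (leaves t) ` S"
    unfolding image_Un left(3) right(3) ..
qed

subsection \<open>The hierarchical decomposition\<close>

text \<open>The first alternative stands for edges of weight \<infinity>, which carry no
  path.\<close>

definition linked :: "'a wgraph \<Rightarrow> ennreal \<Rightarrow> nat \<Rightarrow> 'a \<Rightarrow> 'a \<Rightarrow> bool" where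
  "linked G d b x y \<longleftrightarrow> d = \<infinity> \<or>
     (\<exists>p. path_betw G x p y \<and> walk_weight G p \<le> d \<and> hop p \<le> b)"

text \<open>At stage \<open>i\<close> a cluster is cut along rings of hop-constrained balls; the radius grows by
  \<open>width i\<close> and \<open>h\<close> hops per step, and there are \<open>L\<close> steps. The balls of stage \<open>0\<close> are singletons
  since \<open>width 0\<close> is at most the minimal edge weight \<open>a\<close>.\<close>

locale ring_hierarchy =
  fixes G :: "'a wgraph" and h L :: nat and a :: ennreal
  assumes weighted: "weighted_graph G"
    and a_pos: "0 < a" and a_le: "\<And>e. e \<in> edges G \<Longrightarrow> a \<le> weight G e"
    and L: "2 \<le> L"
begin

text \<open>The scale doubles from stage 1 on; truncated subtraction makes \<open>width 0\<close>
  equal to \<open>width 1\<close>, namely \<open>a\<close>.\<close>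

definition width :: "nat \<Rightarrow> ennreal" where
  "width i = 2 ^ (i - 1) * a"

text \<open>Twice the largest radius \<open>L\<close> steps allow, so that two vertices of a ball
  are joined through its centre within \<open>diam i\<close>.\<close>

definition diam :: "nat \<Rightarrow> ennreal" where
  "diam i = of_nat (2 * L) * width i"

definition ball :: "nat \<Rightarrow> 'a \<Rightarrow> nat \<Rightarrow> 'a set" where
  "ball i v j = (if i = 0 then {v} else
     {x. \<exists>p. is_walk G p \<and> hd p = v \<and> last p = x \<and> hop p \<le> j * h \<and>
       walk_weight G p \<le> of_nat j * width i})"

lemma width_pos: "0 < width i"
  using a_pos by (simp add: width_def ennreal_zero_less_mult_iff zero_less_iff_neq_zero)

lemma diam_pos: "0 < diam i"
  using width_pos[of i] L by (simp add: diam_def ennreal_zero_less_mult_iff)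

lemma width_mono: "width i \<le> width (Suc i)"
proof -
  have "(2 :: ennreal) ^ (i - 1) \<le> 2 ^ i"
    by (intro power_increasing) auto
  then show ?thesis by (simp add: width_def mult_right_mono)
qed

text \<open>Clusters of stage \<open>Suc i\<close> are cut by rings of width \<open>width i\<close>,
  so a piece that pays for such a ring pays for a joining edge of weight \<open>diam (Suc i)\<close>
  up to the factor \<open>4 * L\<close>.\<close>

lemma diam_Suc_le: "diam (Suc i) \<le> of_nat (4 * L) * width i"
proof -
  have "(2 :: ennreal) ^ i \<le> 2 * 2 ^ (i - 1)" by (cases i) auto
  then have "of_nat (2 * L) * (2 ^ i * a) \<le> of_nat (2 * L) * (2 * 2 ^ (i - 1) * a)"
    by (intro mult_left_mono mult_right_mono) auto
  then show ?thesis by (simp add: diam_def width_def algebra_simps)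
qed

lemma center_in_ball: "v \<in> verts G \<Longrightarrow> v \<in> ball i v j"
  by (auto simp: ball_def hop_eq intro!: exI[of _ "[v]"])

lemma ball_mono:
  assumes "j \<le> j'"
  shows "ball i v j \<subseteq> ball i v j'"
proof
  fix x assume x: "x \<in> ball i v j"
  show "x \<in> ball i v j'"
  proof (cases "i = 0")
    case False
    then obtain p where p: "is_walk G p" "hd p = v" "last p = x" "hop p \<le> j * h"
      "walk_weight G p \<le> of_nat j * width i"
      using x by (auto simp: ball_def)
    have "j * h \<le> j' * h" using assms by simp
    moreover have "of_nat j * width i \<le> of_nat j' * width i"
      using assms by (intro mult_right_mono) (simp_all add: of_nat_mono)
    ultimately have "hop p \<le> j' * h" "walk_weight G p \<le> of_nat j' * width i"
      using p(4,5) by (blast intro: order.trans)+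
    then show ?thesis using False p by (auto simp: ball_def)
  qed (use x in \<open>simp add: ball_def\<close>)
qed

text \<open>A lighter path with at most \<open>h\<close> hops, appended to a walk from the centre to
  \<open>x\<close>, would put \<open>y\<close> into the next ball.\<close>

lemma width_le_hop_dist:
  assumes "x \<in> ball i v j" "y \<notin> ball i v (Suc j)"
  shows "width i \<le> hop_dist G h x y"
  unfolding hop_dist_def
proof (rule INF_greatest)
  fix p assume "p \<in> {p. path_betw G x p y \<and> hop p \<le> h}"
  then have p: "is_walk G p" "hd p = x" "last p = y" "hop p \<le> h"
    by (auto simp: path_betw_def)
  show "width i \<le> walk_weight G p"
  proof (cases "i = 0")
    case True
    then have "x \<noteq> y" using assms by (auto simp: ball_def)
    then obtain z q where q: "p = x # z # q" using p by (cases p rule: remdups_adj.cases) auto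
    then have "a \<le> weight G {x, z}" using p a_le by auto
    then show ?thesis using True q by (simp add: width_def add_increasing2)
  next
    case False
    then obtain q where q: "is_walk G q" "hd q = v" "last q = x" "hop q \<le> j * h"
      "walk_weight G q \<le> of_nat j * width i"
      using assms by (auto simp: ball_def)
    note qp = is_walk_append[OF q(1) p(1), unfolded p(2) q(3), OF refl]
    show ?thesis
    proof (rule ccontr)
      assume "\<not> ?thesis"
      then have "walk_weight G q + walk_weight G p \<le> of_nat j * width i + width i"
        using q(5) by (intro add_mono) auto
      then have "walk_weight G (q @ tl p) \<le> of_nat (Suc j) * width i"
        using qp(5) by (simp add: algebra_simps)
      moreover have "hop (q @ tl p) \<le> Suc j * h" using qp(4) q(4) p(4) by simp
      ultimately have "y \<in> ball i v (Suc j)"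
        using False qp q(2) p(3) by (auto simp: ball_def)
      then show False using assms by blast
    qed
  qed
qed

lemma ball_linked:
  assumes "x \<in> ball i v L" "y \<in> ball i v L" "v \<in> verts G"
  shows "linked G (diam i) (2 * L * h) x y"
proof (cases "i = 0")
  case True
  then show ?thesis
    using assms unfolding linked_def ball_def
    by (intro disjI2 exI[of _ "[v]"]) (auto simp: path_betw_def hop_eq)
next
  case False
  then obtain p q where p: "is_walk G p" "hd p = v" "last p = x" "hop p \<le> L * h"
      "walk_weight G p \<le> of_nat L * width i"
    and q: "is_walk G q" "hd q = v" "last q = y" "hop q \<le> L * h"
      "walk_weight G q \<le> of_nat L * width i"
    using assms by (auto simp: ball_def)
  have "p \<noteq> []" using p by auto
  then have r: "is_walk G (rev p)" "hd (rev p) = x" "last (rev p) = v"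
      "hop (rev p) \<le> L * h" "walk_weight G (rev p) \<le> of_nat L * width i"
    using p by (auto simp: is_walk_rev hd_rev last_rev walk_weight_rev hop_eq)
  note rq = is_walk_append[OF r(1) q(1), unfolded r(2,3) q(2,3), OF refl]
  obtain s where s: "path_betw G x s y" "hop s \<le> hop (rev p @ tl q)"
    "walk_weight G s \<le> walk_weight G (rev p @ tl q)"
    using walk_shortcut[OF rq(1)] rq by metis
  have "hop s \<le> 2 * L * h" using s(2) rq(4) r(4) q(4) by simp
  moreover have "walk_weight G s \<le> of_nat L * width i + of_nat L * width i"
    using s(3) rq(5) add_mono[OF r(5) q(5)] by simp
  then have "walk_weight G s \<le> diam i" by (simp add: diam_def algebra_simps mult_2)
  ultimately show ?thesis using s(1) by (auto simp: linked_def)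
qed

text \<open>\<open>cluster i X d t\<close>: the tree \<open>t\<close> arises from \<open>X\<close> by cutting with the stages below \<open>i\<close>; the
  subclusters of \<open>X\<close> are joined by edges of weight \<open>d\<close>.\<close>

inductive cluster :: "nat \<Rightarrow> 'a set \<Rightarrow> ennreal \<Rightarrow> 'a ctree \<Rightarrow> bool" where
  leaf: "cluster 0 {v} d (Leaf v)"
| whole: "cluster i X (diam i) t \<Longrightarrow> v \<in> verts G \<Longrightarrow> X \<subseteq> ball i v L \<Longrightarrow> cluster (Suc i) X d t"
| cut: "cluster (Suc i) (X - ball i v j) d s \<Longrightarrow> cluster i (X \<inter> ball i v (j + 2)) (diam i) t \<Longrightarrow>
    v \<in> verts G \<Longrightarrow> j + 2 \<le> L \<Longrightarrow> cluster (Suc i) X d (Join s d t)"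

section \<open>Properties of all cluster trees\<close>

lemma cluster_leaves: "cluster i X d t \<Longrightarrow> set (leaves t) = X"
proof (induction rule: cluster.induct)
  case (cut i X v j d s t)
  then show ?case using ball_mono[of j "j + 2" i v] by auto
qed auto

text \<open>Repeated cuts at one stage do not add depth: the outer part keeps its root and stage,
  and only the ball part, one stage lower, hangs one level deeper.\<close>

lemma cluster_dep: "cluster i X d t \<Longrightarrow> m < length (leaves t) \<Longrightarrow> dep t m \<le> i"
  by (induction arbitrary: m rule: cluster.induct) (auto simp: Let_def intro: le_SucI)

lemma cluster_wt_pos:
  "cluster i X d t \<Longrightarrow> 0 < d \<Longrightarrow> 0 < m \<Longrightarrow> m < length (leaves t) \<Longrightarrow> 0 < wt t m"
  by (induction arbitrary: m rule: cluster.induct) (auto simp: Let_def diam_pos)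

text \<open>The joining edge runs between the leftmost leaves of \<open>s\<close> and
  \<open>t\<close>, both in \<open>X\<close>, so the hypothesis on \<open>X\<close> supplies its
  path. Inside a ball, \<open>ball_linked\<close> renews that hypothesis with
  \<open>diam i\<close>.\<close>

lemma cluster_linked:
  assumes "cluster i X d t" "\<And>x y. x \<in> X \<Longrightarrow> y \<in> X \<Longrightarrow> linked G d (2 * L * h) x y"
    and "0 < m" "m < length (leaves t)"
  shows "linked G (wt t m) (2 * L * h) (leaves t ! m) (leaves t ! par t m)"
  using assms
proof (induction arbitrary: m rule: cluster.induct)
  case (leaf v d)
  then show ?case by simp
next
  case (whole i X t v d)
  show ?case
  proof (rule whole.IH[OF _ whole(6,7)])
    fix x y assume "x \<in> X" "y \<in> X"
    then show "linked G (diam i) (2 * L * h) x y"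
      using whole(2,3) by (intro ball_linked[of _ _ v]) auto
  qed
next
  case (cut i X v j d s t)
  let ?n = "length (leaves s)"
  consider "m < ?n" | "m = ?n" | "?n < m" by linarith
  then show ?case
  proof cases
    case 1
    then have "linked G (wt s m) (2 * L * h) (leaves s ! m) (leaves s ! par s m)"
      using cut by auto
    then show ?thesis using 1 par_less[OF cut.prems(2) 1] by (simp add: nth_append Let_def)
  next
    case 2
    have "leaves s ! 0 \<in> set (leaves s)" "leaves t ! 0 \<in> set (leaves t)" by simp_all
    then have "leaves s ! 0 \<in> X" "leaves t ! 0 \<in> X"
      using cluster_leaves[OF cut(1)] cluster_leaves[OF cut(2)] by auto
    then show ?thesis using 2 cut.prems(1) by (simp add: nth_append)
  next
    case 3
    have "linked G (wt t (m - ?n)) (2 * L * h) (leaves t ! (m - ?n)) (leaves t ! par t (m - ?n))"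
    proof (rule cut.IH(2))
      fix x y assume "x \<in> X \<inter> ball i v (j + 2)" "y \<in> X \<inter> ball i v (j + 2)"
      then show "linked G (diam i) (2 * L * h) x y"
        using cut(3) ball_mono[OF cut(4), of i v] by (intro ball_linked[of _ _ v]) auto
    qed (use 3 cut.prems in auto)
    then show ?thesis using 3 by (simp add: nth_append Let_def)
  qed
qed

text \<open>Centering the ball at \<open>r\<close> whenever possible keeps \<open>r\<close> out of all rings, hence unduplicated.\<close>

lemma cluster_exists:
  fixes q :: real
  assumes ring: "\<And>(x :: nat \<Rightarrow> nat) m. 1 \<le> x 0 \<Longrightarrow> (\<And>j. x j \<le> m) \<Longrightarrow> m \<le> card (verts G) \<Longrightarrow>
      \<exists>j. 2 * j + 2 \<le> L \<and> real (x (Suc j)) powr q + real (m - x j) powr q \<le> real m powr q"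
    and "X \<subseteq> verts G" "X \<noteq> {}" "i = 0 \<Longrightarrow> \<exists>v. X = {v}"
  shows "\<exists>t. cluster i X d t \<and> real (length (leaves t)) \<le> real (card X) powr q \<and>
    count_list (leaves t) r \<le> 1"
  using assms(2-)
proof (induction i arbitrary: X d)
  case 0
  then obtain v where "X = {v}" by auto
  then show ?case by (intro exI[of _ "Leaf v"]) (auto intro: cluster.intros)
next
  case (Suc i)
  have fin: "finite (verts G)" using weighted by (simp add: weighted_graph_def)
  from Suc(2,3) show ?case
  proof (induction "card X" arbitrary: X rule: less_induct)
    case less
    have finX: "finite X" using less(2) fin finite_subset by auto
    obtain v where v: "v \<in> X" "r \<in> X \<Longrightarrow> v = r" using less(3) by auto
    then have vG: "v \<in> verts G" using less(2) by auto
    \<comment> \<open>Radii advance by two, leaving an intermediate ball between the inner and the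
      outer one for the cut of \<open>H\<close>.\<close>
    obtain j where j: "2 * j + 2 \<le> L"
      "real (card (X \<inter> ball i v (2 * Suc j))) powr q +
       real (card X - card (X \<inter> ball i v (2 * j))) powr q \<le> real (card X) powr q"
    proof -
      have "1 \<le> card (X \<inter> ball i v (2 * 0))"
        using v vG center_in_ball[of v i] finX by (auto simp: Suc_le_eq card_gt_0_iff)
      then show ?thesis
        using ring[of "\<lambda>j. card (X \<inter> ball i v (2 * j))" "card X"] that finX less(2) fin
        by (auto simp: card_mono)
    qed
    define A B where "A = ball i v (2 * j)" and "B = ball i v (2 * j + 2)"
    have cardA: "card X - card (X \<inter> A) = card (X - A)"
      using finX by (simp add: card_Diff_subset_Int)
    have vA: "v \<in> A" and vB: "v \<in> B" using center_in_ball[OF vG] by (auto simp: A_def B_def)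
    have "\<exists>t. cluster i (X \<inter> B) (diam i) t \<and>
        real (length (leaves t)) \<le> real (card (X \<inter> B)) powr q \<and> count_list (leaves t) r \<le> 1"
      using less(2) v vB by (intro Suc.IH) (auto simp: B_def ball_def)
    then obtain t where t: "cluster i (X \<inter> B) (diam i) t"
      "real (length (leaves t)) \<le> real (card (X \<inter> B)) powr q" "count_list (leaves t) r \<le> 1"
      by blast
    show ?case
    proof (cases "X - A = {}")
      \<comment> \<open>The inner ball already contains \<open>X\<close>, so the stage ends without
        a cut.\<close>
      case True
      then have "X \<subseteq> B" using ball_mono[of "2 * j" "2 * j + 2" i v] by (auto simp: A_def B_def)
      then have "X \<inter> B = X" by auto
      moreover have "X \<subseteq> ball i v L"
        using \<open>X \<subseteq> B\<close> ball_mono[OF j(1), of i v] by (auto simp: B_def)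
      ultimately show ?thesis using t vG by (intro exI[of _ t]) (auto intro: cluster.whole)
    next
      case False
      have "card (X - A) < card X" using v vA finX by (intro psubset_card_mono) auto
      then obtain s where s: "cluster (Suc i) (X - A) d s"
        "real (length (leaves s)) \<le> real (card (X - A)) powr q" "count_list (leaves s) r \<le> 1"
        using less(1)[of "X - A"] less(2) False by auto
      have "cluster (Suc i) X d (Join s d t)"
        using s(1) t(1) vG j(1) unfolding A_def B_def by (rule cluster.cut)
      moreover have "real (length (leaves (Join s d t))) \<le> real (card X) powr q"
        using s(2) t(2) j(2) cardA by (simp add: A_def B_def)
      moreover have "count_list (leaves (Join s d t)) r \<le> 1"
      \<comment> \<open>If \<open>r\<close> is in \<open>X\<close>, it is the centre and lies in
        \<open>A\<close>, so \<open>s\<close> misses it; otherwise \<open>t\<close> misses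
        it.\<close>
      proof (cases "r \<in> X")
        case True
        then have "r \<notin> set (leaves s)" using cluster_leaves[OF s(1)] v vA by auto
        then show ?thesis using t(3) by (simp add: count_list_append)
      next
        case False
        then have "r \<notin> set (leaves t)" using cluster_leaves[OF t(1)] by auto
        then show ?thesis using s(3) by (simp add: count_list_append)
      qed
      ultimately show ?thesis by blast
    qed
  qed
qed

end

subsection \<open>Embedding subgraphs\<close>

locale respecting_subgraph = ring_hierarchy +
  fixes H :: "'a wgraph"
  assumes sub: "subgraph H G" and conn: "connected_graph H" and resp: "h_respecting h G H"
begin

lemma weighted_H: "weighted_graph H"
  using sub by (simp add: subgraph_def)

text \<open>Here \<open>h_respecting\<close> enters: distances in \<open>H\<close> dominate
  hop-constrained distances in \<open>G\<close>, so balls of consecutive radii are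
  \<open>width i\<close> apart in \<open>H\<close>. The radii \<open>j\<close>,
  \<open>Suc j\<close>, \<open>j + 2\<close> give the three sets for
  \<open>well_cut_split\<close>.\<close>

lemma ball_split:
  assumes "Q \<subseteq> verts H" "well_cut H (width i) Q"
  obtains Q1 Q2 where "Q = Q1 \<union> Q2" "Q1 \<inter> Q2 = {}" "Q1 \<subseteq> ball i v (j + 2)"
    "Q2 \<inter> ball i v j = {}" "well_cut H (width i) Q1" "well_cut H (width i) Q2"
proof -
  have *: "width i \<le> graph_dist H x y"
    if "x \<in> ball i v j' \<inter> verts H" "y \<in> verts H - ball i v (Suc j')" for x y j'
    using that width_le_hop_dist[of x i v j' y] resp
    unfolding h_respecting_def by (blast intro: order.trans)
  show ?thesis
    using well_cut_split[of H Q "ball i v j" "ball i v (Suc j)" "ball i v (j + 2)" "width i"]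
      weighted_H assms ball_mono[of j "Suc j" i v] ball_mono[of "Suc j" "j + 2" i v]
      *[of _ j] *[of _ "Suc j"] that
    by auto
qed

text \<open>\<open>Q1\<close> drops to stage \<open>i\<close>, so its budget has one spare share,
  which pays for \<open>d\<close>. Disjointness makes the two budgets add up.\<close>

lemma join_cover:
  assumes "subtree s S 0" "Q2 \<subseteq> (!) (leaves s) ` S"
    and "(\<Sum>m\<in>S - {0}. wt s m) \<le> of_nat (4 * L) * of_nat (Suc i) * incident_weight H Q2"
    and "subtree t R 0" "Q1 \<subseteq> (!) (leaves t) ` R"
    and "(\<Sum>m\<in>R - {0}. wt t m) \<le> of_nat (4 * L) * of_nat i * incident_weight H Q1"
    and d: "d \<le> of_nat (4 * L) * incident_weight H Q1" and disj: "Q1 \<inter> Q2 = {}"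
  shows "\<exists>U. subtree (Join s d t) U 0 \<and> Q1 \<union> Q2 \<subseteq> (!) (leaves (Join s d t)) ` U \<and>
    (\<Sum>m\<in>U - {0}. wt (Join s d t) m) \<le>
      of_nat (4 * L) * of_nat (Suc i) * incident_weight H (Q1 \<union> Q2)"
proof -
  let ?c = "of_nat (4 * L) :: ennreal"
  note both = subtree_Join_both[OF assms(1,4), of d]
  have "(\<Sum>m\<in>S - {0}. wt s m) + (d + (\<Sum>m\<in>R - {0}. wt t m)) \<le>
      ?c * of_nat (Suc i) * incident_weight H Q2 +
      (?c * incident_weight H Q1 + ?c * of_nat i * incident_weight H Q1)"
    using assms(3,6) d by (intro add_mono)
  also have "\<dots> = ?c * of_nat (Suc i) * incident_weight H (Q1 \<union> Q2)"
    unfolding incident_weight_Un[OF weighted_H disj] by (simp add: algebra_simps)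
  finally have "(\<Sum>m\<in>S - {0}. wt s m) + (d + (\<Sum>m\<in>R - {0}. wt t m)) \<le>
    ?c * of_nat (Suc i) * incident_weight H (Q1 \<union> Q2)" .
  moreover have "Q1 \<union> Q2 \<subseteq> (!) (leaves s) ` S \<union> (!) (leaves t) ` R" using assms(2,5) by auto
  ultimately show ?thesis using both by metis
qed

text \<open>For a piece already separated from the rest of \<open>H\<close>. It must reach the root
  0 in order to be joined to the other pieces, and being proper, it has enough incident weight at
  every further split.\<close>

lemma rooted_subtree:
  assumes "cluster i X d t" "Q \<subseteq> X" "Q \<subseteq> verts H" "Q \<noteq> {}" "Q \<noteq> verts H"
    and "\<And>i'. i = Suc i' \<Longrightarrow> well_cut H (width i') Q \<and> d \<le> of_nat (4 * L) * width i'"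
  shows "\<exists>R. subtree t R 0 \<and> Q \<subseteq> (!) (leaves t) ` R \<and>
    (\<Sum>m\<in>R - {0}. wt t m) \<le> of_nat (4 * L) * of_nat i * incident_weight H Q"
  using assms
proof (induction arbitrary: Q rule: cluster.induct)
  case (leaf v d)
  then show ?case using subtree_root by (intro exI[of _ "{0}"]) auto
next
  case (whole i X t v d)
  have "\<exists>R. subtree t R 0 \<and> Q \<subseteq> (!) (leaves t) ` R \<and>
    (\<Sum>m\<in>R - {0}. wt t m) \<le> of_nat (4 * L) * of_nat i * incident_weight H Q"
  proof (rule whole.IH)
    fix i' assume "i = Suc i'"
    then show "well_cut H (width i') Q \<and> diam i \<le> of_nat (4 * L) * width i'"
      using whole.prems(5)[OF refl] width_mono[of i'] diam_Suc_le well_cut_mono by blast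
  qed (use whole.prems in auto)
  moreover have "(of_nat (4 * L) * of_nat i * incident_weight H Q :: ennreal) \<le>
      of_nat (4 * L) * of_nat (Suc i) * incident_weight H Q"
    by (intro mult_right_mono mult_left_mono of_nat_mono) auto
  ultimately show ?case by (blast intro: order.trans)
next
  case (cut i X v j d s t)
  let ?c = "of_nat (4 * L) :: ennreal"
  have cutQ: "well_cut H (width i) Q" and d: "d \<le> ?c * width i" using cut.prems(5) by auto
  obtain Q1 Q2 where Q: "Q = Q1 \<union> Q2" "Q1 \<inter> Q2 = {}" "Q1 \<subseteq> ball i v (j + 2)"
    "Q2 \<inter> ball i v j = {}" "well_cut H (width i) Q1" "well_cut H (width i) Q2"
    using ball_split[OF cut.prems(2) cutQ] by metis
  have ne: "Q1 \<noteq> verts H" "Q2 \<noteq> verts H" using Q cut.prems by auto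
  obtain S where S: "subtree s S 0" "Q2 \<subseteq> (!) (leaves s) ` S"
    "(\<Sum>m\<in>S - {0}. wt s m) \<le> ?c * of_nat (Suc i) * incident_weight H Q2"
  \<comment> \<open>An empty \<open>Q2\<close> is served by the root alone at no cost, which still
    provides the vertex to which \<open>t\<close> is attached.\<close>
  proof (cases "Q2 = {}")
    case True
    then show ?thesis using that[of "{0}"] subtree_root by auto
  next
    case False
    then have "\<exists>R. subtree s R 0 \<and> Q2 \<subseteq> (!) (leaves s) ` R \<and>
        (\<Sum>m\<in>R - {0}. wt s m) \<le> ?c * of_nat (Suc i) * incident_weight H Q2"
      using Q cut.prems d ne by (intro cut.IH(1)) auto
    then show ?thesis using that by blast
  qed
  show ?case
  proof (cases "Q1 = {}")
    case True
    then show ?thesis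
      using S subtree_Join_left[OF S(1), of d t] Q(1) by (intro exI[of _ S]) auto
  next
    case False
    have "\<exists>R. subtree t R 0 \<and> Q1 \<subseteq> (!) (leaves t) ` R \<and>
        (\<Sum>m\<in>R - {0}. wt t m) \<le> ?c * of_nat i * incident_weight H Q1"
    proof (rule cut.IH(2))
      fix i' assume "i = Suc i'"
      then show "well_cut H (width i') Q1 \<and> diam i \<le> ?c * width i'"
        using Q(5) width_mono[of i'] diam_Suc_le well_cut_mono by blast
    qed (use Q cut.prems False ne in auto)
    then obtain R where R: "subtree t R 0" "Q1 \<subseteq> (!) (leaves t) ` R"
      "(\<Sum>m\<in>R - {0}. wt t m) \<le> ?c * of_nat i * incident_weight H Q1" by blast
    have "d \<le> ?c * incident_weight H Q1"
      using d well_cutD[OF Q(5) False ne(1)] by (meson mult_left_mono order.trans zero_le)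
    from join_cover[OF S R this Q(2)] show ?thesis unfolding Q(1) .
  qed
qed

text \<open>For \<open>H\<close> as a whole, as long as it is not split, the subtree need not reach
  the root. The last hypothesis says that a joining edge is affordable, or that \<open>H\<close> is
  too light to be split at this scale; the latter covers \<open>d = \<infinity>\<close> at the
  top.\<close>

lemma covering_subtree:
  assumes "cluster i X d t" "verts H \<subseteq> X"
    and "\<And>i'. i = Suc i' \<Longrightarrow> d \<le> of_nat (4 * L) * width i' \<or>
      incident_weight H (verts H) < width i'"
  shows "\<exists>R \<rho>. subtree t R \<rho> \<and> verts H \<subseteq> (!) (leaves t) ` R \<and>
    (\<Sum>m\<in>R - {\<rho>}. wt t m) \<le> of_nat (4 * L) * of_nat i * incident_weight H (verts H)"
  using assms
proof (induction rule: cluster.induct)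
  case (leaf v d)
  then show ?case using subtree_root by (intro exI[of _ "{0}"] exI[of _ 0]) auto
next
  case (whole i X t v d)
  have "\<exists>R \<rho>. subtree t R \<rho> \<and> verts H \<subseteq> (!) (leaves t) ` R \<and>
    (\<Sum>m\<in>R - {\<rho>}. wt t m) \<le> of_nat (4 * L) * of_nat i * incident_weight H (verts H)"
    using whole.prems diam_Suc_le by (intro whole.IH) auto
  moreover have "(of_nat (4 * L) * of_nat i * incident_weight H (verts H) :: ennreal) \<le>
      of_nat (4 * L) * of_nat (Suc i) * incident_weight H (verts H)"
    by (intro mult_right_mono mult_left_mono of_nat_mono) auto
  ultimately show ?case by (blast intro: order.trans)
next
  case (cut i X v j d s t)
  let ?c = "of_nat (4 * L) :: ennreal" and ?V = "verts H"
  have V: "?V \<noteq> {}" using conn by (simp add: connected_graph_def)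
  obtain Q1 Q2 where Q: "?V = Q1 \<union> Q2" "Q1 \<inter> Q2 = {}" "Q1 \<subseteq> ball i v (j + 2)"
    "Q2 \<inter> ball i v j = {}" "well_cut H (width i) Q1" "well_cut H (width i) Q2"
    using ball_split[OF order.refl well_cut_verts[OF conn]] by metis
  have incV: "incident_weight H ?V = incident_weight H Q1 + incident_weight H Q2"
    unfolding Q(1) by (rule incident_weight_Un[OF weighted_H Q(2)])
  consider "Q1 = {}" | "Q2 = {}" | "Q1 \<noteq> {}" "Q2 \<noteq> {}" by blast
  then show ?case
  proof cases
    \<comment> \<open>\<open>H\<close> lies on one side of the ring, here the outer one: the subtree
      follows it and no joining edge is paid.\<close>
    case 1
    then have "?V \<subseteq> X - ball i v j" using Q cut.prems by auto
    then obtain R \<rho> where R: "subtree s R \<rho>" "?V \<subseteq> (!) (leaves s) ` R"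
      "(\<Sum>m\<in>R - {\<rho>}. wt s m) \<le> ?c * of_nat (Suc i) * incident_weight H ?V"
      using cut.IH(1) cut.prems by blast
    then show ?thesis using subtree_Join_left[OF R(1), of d t] by metis
  next
    case 2
    then have "?V \<subseteq> X \<inter> ball i v (j + 2)" using Q cut.prems by auto
    then obtain R \<rho> where R: "subtree t R \<rho>" "?V \<subseteq> (!) (leaves t) ` R"
      "(\<Sum>m\<in>R - {\<rho>}. wt t m) \<le> ?c * of_nat i * incident_weight H ?V"
      using cut.IH(2) diam_Suc_le by blast
    note right = subtree_Join_right[OF R(1), of s d]
    have "(?c * of_nat i * incident_weight H ?V :: ennreal) \<le>
        ?c * of_nat (Suc i) * incident_weight H ?V"
      by (intro mult_right_mono mult_left_mono of_nat_mono) auto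
    then show ?thesis using right R(2,3) by (metis order.trans)
  next
    case 3
    then have ne: "Q1 \<noteq> ?V" "Q2 \<noteq> ?V" using Q(1,2) by auto
    \<comment> \<open>A genuine split forces the incident weight of \<open>H\<close> up to
      \<open>width i\<close>, which excludes the second alternative for \<open>d\<close>.\<close>
    have w: "width i \<le> incident_weight H Q1" using well_cutD[OF Q(5)] 3 ne by blast
    also have "\<dots> \<le> incident_weight H ?V" by (simp add: incV)
    finally have d: "d \<le> ?c * width i" using cut.prems(2)[OF refl] by auto
    have "\<exists>R. subtree s R 0 \<and> Q2 \<subseteq> (!) (leaves s) ` R \<and>
        (\<Sum>m\<in>R - {0}. wt s m) \<le> ?c * of_nat (Suc i) * incident_weight H Q2"
      using Q cut.prems(1) d ne 3 by (intro rooted_subtree[OF cut.hyps(1)]) auto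
    then obtain S where S: "subtree s S 0" "Q2 \<subseteq> (!) (leaves s) ` S"
      "(\<Sum>m\<in>S - {0}. wt s m) \<le> ?c * of_nat (Suc i) * incident_weight H Q2" by blast
    have "\<exists>R. subtree t R 0 \<and> Q1 \<subseteq> (!) (leaves t) ` R \<and>
        (\<Sum>m\<in>R - {0}. wt t m) \<le> ?c * of_nat i * incident_weight H Q1"
    proof (rule rooted_subtree[OF cut.hyps(2)])
      fix i' assume "i = Suc i'"
      then show "well_cut H (width i') Q1 \<and> diam i \<le> ?c * width i'"
        using Q(5) width_mono[of i'] diam_Suc_le well_cut_mono by blast
    qed (use Q cut.prems 3 ne in auto)
    then obtain R where R: "subtree t R 0" "Q1 \<subseteq> (!) (leaves t) ` R"
      "(\<Sum>m\<in>R - {0}. wt t m) \<le> ?c * of_nat i * incident_weight H Q1" by blast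
    have "d \<le> ?c * incident_weight H Q1"
      using d w by (meson mult_left_mono order.trans zero_le)
    from join_cover[OF S R this Q(2)] show ?thesis unfolding Q(1) by blast
  qed
qed

end

subsection \<open>The embedding given by a cluster tree\<close>

definition embedding_tree :: "'a ctree \<Rightarrow> nat wgraph" where
  "embedding_tree t = parent_graph {..<length (leaves t)} 0 (par t) (wt t)"

definition copies :: "'a ctree \<Rightarrow> 'a \<Rightarrow> nat set" where
  "copies t v = {m. m < length (leaves t) \<and> leaves t ! m = v}"

definition edge_path :: "'a wgraph \<Rightarrow> nat \<Rightarrow> 'a ctree \<Rightarrow> nat \<Rightarrow> 'a list" where
  "edge_path G b t m = (SOME p. path_betw G (leaves t ! m) p (leaves t ! par t m) \<and>
     walk_weight G p \<le> wt t m \<and> hop p \<le> b)"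

text \<open>\<open>edge_path\<close> runs from child to parent and the child has the larger number,
  so an edge read towards the larger number is reversed.\<close>

definition tree_path :: "'a wgraph \<Rightarrow> nat \<Rightarrow> 'a ctree \<Rightarrow> nat \<Rightarrow> nat \<Rightarrow> 'a list" where
  "tree_path G b t x y = (if x < y then rev (edge_path G b t y) else edge_path G b t x)"

lemma parent_closed_leaves: "parent_closed {..<length (leaves t)} 0 (par t)"
  using par_less[of _ t] by (auto simp: parent_closed_def intro: less_trans)

lemma verts_embedding_tree [simp]: "verts (embedding_tree t) = {..<length (leaves t)}"
  by (simp add: embedding_tree_def)

lemma hop_path_concat:
  assumes "successively (\<lambda>x y. P x y \<noteq> [] \<and> hop (P x y) \<le> b) q"
  shows "hop (path_concat P q) \<le> (length q - 1) * b"
  using assms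
proof (induction P q rule: path_concat.induct)
  case (1 P x y q)
  then have "hop (path_concat P (y # q)) \<le> length q * b" "P x y \<noteq> []" "hop (P x y) \<le> b"
    by auto
  moreover from this have "hop (path_concat P (x # y # q)) \<le>
      hop (P x y) + hop (path_concat P (y # q))"
    by (simp add: hop_eq Suc_le_eq)
  ultimately show ?case by simp
qed (auto simp: hop_eq)

lemma edge_path:
  assumes "linked G (wt t m) b (leaves t ! m) (leaves t ! par t m)" "wt t m < \<infinity>"
  shows "path_betw G (leaves t ! m) (edge_path G b t m) (leaves t ! par t m)"
    "walk_weight G (edge_path G b t m) \<le> wt t m" "hop (edge_path G b t m) \<le> b"
proof -
  have "\<exists>p. path_betw G (leaves t ! m) p (leaves t ! par t m) \<and>
     walk_weight G p \<le> wt t m \<and> hop p \<le> b"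
    using assms by (auto simp: linked_def)
  from someI_ex[OF this] show "path_betw G (leaves t ! m) (edge_path G b t m) (leaves t ! par t m)"
    "walk_weight G (edge_path G b t m) \<le> wt t m" "hop (edge_path G b t m) \<le> b"
    unfolding edge_path_def by auto
qed

lemma embedding_tree_edgeE:
  assumes "{x, y} \<in> edges (embedding_tree t)"
  obtains "y = par t x" "y < x" "0 < x" "x < length (leaves t)" "weight (embedding_tree t) {x, y} = wt t x"
  | "x = par t y" "x < y" "0 < y" "y < length (leaves t)" "weight (embedding_tree t) {x, y} = wt t y"
  using parent_graph_edgeD[OF parent_closed_leaves assms[unfolded embedding_tree_def]] that
  by (auto simp: embedding_tree_def)

lemma tree_path:
  assumes linked: "\<And>m. 0 < m \<Longrightarrow> m < length (leaves t) \<Longrightarrow>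
      linked G (wt t m) b (leaves t ! m) (leaves t ! par t m)"
    and e: "{x, y} \<in> edges (embedding_tree t)" "weight (embedding_tree t) {x, y} < \<infinity>"
  shows "path_betw G (leaves t ! x) (tree_path G b t x y) (leaves t ! y)"
    "walk_weight G (tree_path G b t x y) \<le> weight (embedding_tree t) {x, y}"
    "hop (tree_path G b t x y) \<le> b"
    "tree_path G b t y x = rev (tree_path G b t x y)"
proof -
  have "path_betw G (leaves t ! x) (tree_path G b t x y) (leaves t ! y) \<and>
    walk_weight G (tree_path G b t x y) \<le> weight (embedding_tree t) {x, y} \<and>
    hop (tree_path G b t x y) \<le> b \<and> tree_path G b t y x = rev (tree_path G b t x y)"
    using e(1)
  proof (cases rule: embedding_tree_edgeE)
    case 1
    then show ?thesis
      using edge_path[OF linked[of x]] e(2) by (simp add: tree_path_def)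
  next
    case 2
    then show ?thesis
      using edge_path[OF linked[of y]] e(2)
      by (simp add: tree_path_def path_betw_rev walk_weight_rev hop_eq)
  qed
  then show "path_betw G (leaves t ! x) (tree_path G b t x y) (leaves t ! y)"
    "walk_weight G (tree_path G b t x y) \<le> weight (embedding_tree t) {x, y}"
    "hop (tree_path G b t x y) \<le> b"
    "tree_path G b t y x = rev (tree_path G b t x y)"
    by auto
qed

text \<open>For domination, a tree walk of finite weight expands edge by edge into a walk of
  \<open>G\<close> that is no heavier; a walk of infinite weight gives a trivial bound.\<close>

lemma path_tree_embedding_ctree:
  assumes leaves: "set (leaves t) = verts G"
    and pos: "\<And>m. 0 < m \<Longrightarrow> m < length (leaves t) \<Longrightarrow> 0 < wt t m"
    and linked: "\<And>m. 0 < m \<Longrightarrow> m < length (leaves t) \<Longrightarrow>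
      linked G (wt t m) b (leaves t ! m) (leaves t ! par t m)"
  shows "path_tree_embedding G (embedding_tree t) (copies t) (tree_path G b t)"
    and "\<Union> (copies t ` verts G) = {..<length (leaves t)}"
proof -
  let ?T = "embedding_tree t"
  note path = tree_path[OF linked]
  have "is_tree ?T"
    unfolding is_tree_def embedding_tree_def
    using weighted_parent_graph[OF parent_closed_leaves, of t "wt t"]
      connected_parent_graph[OF parent_closed_leaves, of t]
      acyclic_parent_graph[OF parent_closed_leaves, of t] pos
    by auto
  moreover have "one_to_many_embedding G ?T (copies t)"
    using leaves unfolding one_to_many_embedding_def disjoint_family_on_def copies_def
    by (auto simp: in_set_conv_nth)
  moreover show copies: "\<Union> (copies t ` verts G) = {..<length (leaves t)}"
    using leaves by (auto simp: copies_def)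
  moreover have "dominating G ?T (copies t)"
  proof -
    have *: "\<exists>p. is_walk G p \<and> hd p = leaves t ! hd q \<and> last p = leaves t ! last q \<and>
        walk_weight G p \<le> walk_weight ?T q"
      if "is_walk ?T q" "walk_weight ?T q < \<infinity>" for q
      using that
    proof (induction q rule: induct_list012)
      case (2 x)
      then have "leaves t ! x \<in> verts G" unfolding leaves[symmetric] by simp
      then show ?case by (intro exI[of _ "[leaves t ! x]"]) auto
    next
      case (3 x y q)
      have fin: "weight ?T {x, y} < \<infinity>" "walk_weight ?T (y # q) < \<infinity>" using 3(4) by auto
      obtain p where p: "is_walk G p" "hd p = leaves t ! y" "last p = leaves t ! last (y # q)"
        "walk_weight G p \<le> walk_weight ?T (y # q)"
        using 3(2)[OF _ fin(2)] 3(3) unfolding is_walk_simps list.sel by blast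
      note xy = path[of x y]
      have e: "{x, y} \<in> edges ?T" using 3(3) by auto
      let ?r = "tree_path G b t x y"
      have r: "is_walk G ?r" "hd ?r = leaves t ! x" "last ?r = leaves t ! y"
        "walk_weight G ?r \<le> weight ?T {x, y}"
        using xy e fin by (auto simp: path_betw_def)
      note rp = is_walk_append[OF r(1) p(1), unfolded r(2,3) p(2,3), OF refl]
      show ?case
        using rp add_mono[OF r(4) p(4)] by (intro exI[of _ "?r @ tl p"]) auto
    qed simp
    have "graph_dist G (leaves t ! x) (leaves t ! y) \<le> graph_dist ?T x y" for x y
      unfolding graph_dist_def[of ?T]
    proof (rule INF_greatest)
      fix q assume "q \<in> {q. path_betw ?T x q y}"
      then have q: "is_walk ?T q" "hd q = x" "last q = y" by (auto simp: path_betw_def)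
      show "graph_dist G (leaves t ! x) (leaves t ! y) \<le> walk_weight ?T q"
      proof (cases "walk_weight ?T q < \<infinity>")
        case True
        then obtain p where "is_walk G p" "hd p = leaves t ! x" "last p = leaves t ! y"
          "walk_weight G p \<le> walk_weight ?T q"
          using *[OF q(1)] q by auto
        then show ?thesis using graph_dist_le_walk[of G p] by auto
      next
        case False
        then show ?thesis by (simp add: less_top[symmetric])
      qed
    qed
    then show ?thesis by (auto simp: dominating_def copies_def)
  qed
  moreover have "associated_paths G ?T (copies t) (tree_path G b t)"
    using path by (auto simp: associated_paths_def copies_def)
  ultimately show "path_tree_embedding G ?T (copies t) (tree_path G b t)"
    by (simp add: path_tree_embedding_def)
qed

text \<open>Depth at most \<open>i\<close> leaves at most \<open>2 * i\<close> edges on a tree path,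
  each expanding to at most \<open>b\<close> hops.\<close>

lemma has_hop_bound_ctree:
  assumes dep: "\<And>m. m < length (leaves t) \<Longrightarrow> dep t m \<le> i"
    and linked: "\<And>m. 0 < m \<Longrightarrow> m < length (leaves t) \<Longrightarrow>
      linked G (wt t m) b (leaves t ! m) (leaves t ! par t m)"
  shows "has_hop_bound (embedding_tree t) (tree_path G b t) (real (2 * i * b))"
  unfolding has_hop_bound_def
proof (intro ballI allI impI, elim conjE)
  let ?T = "embedding_tree t"
  fix x y q assume x: "x \<in> verts ?T" and y: "y \<in> verts ?T" and q: "path_betw ?T x q y"
    and fin: "\<forall>e\<in>set (walk_edges q). weight ?T e < \<infinity>"
  have walk: "is_walk ?T q" "distinct q" "hd q = x" "last q = y"
    using q by (auto simp: path_betw_def)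
  have "successively (\<lambda>x y. tree_path G b t x y \<noteq> [] \<and> hop (tree_path G b t x y) \<le> b) q"
    using walk(1) fin
  proof (induction q rule: induct_list012)
    case (3 x y q)
    then show ?case
      using tree_path(1,3)[OF linked, of x y] by (auto simp: path_betw_def)
  qed auto
  then have "hop (path_concat (tree_path G b t) q) \<le> (length q - 1) * b"
    by (rule hop_path_concat)
  moreover have "length q \<le> Suc (dep t x + dep t y)"
  proof -
    have "length q \<le> Suc (dep t (hd q) + dep t (last q))"
      using walk dep_par[of _ t] unfolding embedding_tree_def
      by (intro parent_graph_path_length[OF parent_closed_leaves, where dep = "dep t"]) auto
    then show ?thesis using walk by simp
  qed
  then have "(length q - 1) * b \<le> 2 * i * b"
    using dep[of x] dep[of y] x y by (intro mult_le_mono1) simp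
  ultimately show "real (hop (path_concat (tree_path G b t) q)) \<le> real (2 * i * b)"
    by (simp only: of_nat_le_iff)
qed

lemma card_copies: "card (copies t v) = count_list (leaves t) v"
  by (simp add: copies_def count_list_eq_length_filter length_filter_conv_card eq_commute)

text \<open>At the top the joining edges have weight \<infinity>; \<open>small\<close> ensures that
  none of them is used. The factor 8 is the 4 of \<open>covering_subtree\<close>, doubled because
  incident weight counts each edge at both ends.\<close>

lemma (in ring_hierarchy) subgraph_of_embedding_tree:
  assumes t: "cluster (Suc i) (verts G) \<infinity> t"
    and H: "subgraph H G" "connected_graph H" "h_respecting h G H"
    and small: "2 * total_weight H < width i"
  shows "\<exists>H'. subgraph H' (embedding_tree t) \<and> connected_graph H' \<and>
    (\<forall>u\<in>verts H. verts H' \<inter> copies t u \<noteq> {}) \<and>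
    total_weight H' \<le> of_nat (8 * L * Suc i) * total_weight H"
proof -
  interpret respecting_subgraph G h L a H
    by unfold_locales (use H in auto)
  have inc: "incident_weight H (verts H) = 2 * total_weight H"
    by (rule incident_weight_verts[OF weighted_H])
  obtain R \<rho> where R: "subtree t R \<rho>" "verts H \<subseteq> (!) (leaves t) ` R"
    "(\<Sum>m\<in>R - {\<rho>}. wt t m) \<le> of_nat (4 * L) * of_nat (Suc i) * incident_weight H (verts H)"
    using covering_subtree[OF t] H(1) small inc by (auto simp: subgraph_def)
  have closed: "parent_closed R \<rho> (par t)" and RN: "R \<subseteq> {..<length (leaves t)}"
    using R(1) by (auto simp: subtree_def)
  have pos: "0 < m" if "m \<in> R - {\<rho>}" for m
    using closed that by (auto simp: parent_closed_def)
  define H' where "H' = parent_graph R \<rho> (par t) (wt t)"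
  have "0 < wt t m" if "m \<in> R - {\<rho>}" for m
    using cluster_wt_pos[OF t, of m] pos[OF that] that RN by auto
  then have "weighted_graph H'"
    unfolding H'_def by (rule weighted_parent_graph[OF closed])
  then have "subgraph H' (embedding_tree t)"
    using RN pos by (auto simp: subgraph_def H'_def embedding_tree_def)
  moreover have "connected_graph H'"
    unfolding H'_def by (rule connected_parent_graph[OF closed])
  moreover have "verts H' \<inter> copies t u \<noteq> {}" if "u \<in> verts H" for u
    using that R(2) RN by (auto simp: H'_def copies_def)
  moreover have "total_weight H' \<le> of_nat (8 * L * Suc i) * total_weight H"
    using R(3) unfolding inc H'_def total_weight_parent_graph[OF closed]
    by (simp add: algebra_simps)
  ultimately show ?thesis by blast
qed

subsection \<open>Choice of the parameters\<close>

lemma card_edges_le: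
  assumes "weighted_graph G"
  shows "card (edges G) \<le> card (verts G) ^ 2"
proof -
  have fin: "finite (verts G)" using assms by (simp add: weighted_graph_def)
  have "edges G \<subseteq> (\<lambda>(x, y). {x, y}) ` (verts G \<times> verts G)"
  proof
    fix e assume "e \<in> edges G"
    then have "card e = 2" "e \<subseteq> verts G" using assms by (auto simp: weighted_graph_def)
    then show "e \<in> (\<lambda>(x, y). {x, y}) ` (verts G \<times> verts G)" by (force simp: card_2_iff)
  qed
  then have "card (edges G) \<le> card (verts G \<times> verts G)"
    using fin by (meson card_image_le card_mono finite_SigmaI finite_imageI order.trans)
  then show ?thesis by (simp add: card_cartesian_product power2_eq_square)
qed

lemma edge_weight_bounds:
  assumes G: "weighted_graph G" "finite_weights G"
    and aspect: "edges G \<noteq> {} \<Longrightarrow> aspect_ratio G \<le> ennreal s"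
  obtains a where "0 < a" "a < \<infinity>"
    "\<And>e. e \<in> edges G \<Longrightarrow> a \<le> weight G e \<and> weight G e \<le> ennreal s * a"
proof (cases "edges G = {}")
  \<comment> \<open>Without edges, any positive finite value serves as \<open>a\<close>.\<close>
  case True
  then show ?thesis using that[of 1] by auto
next
  case False
  let ?W = "weight G ` edges G"
  have W: "finite ?W" "?W \<noteq> {}" using False finite_edges[OF G(1)] by auto
  have "Min ?W \<in> ?W" using W by simp
  then have min: "0 < Min ?W" "Min ?W < \<infinity>"
    using G by (auto simp: weighted_graph_def finite_weights_def)
  have "Max ?W = aspect_ratio G * Min ?W"
    using min by (simp add: aspect_ratio_def ennreal_divide_times ennreal_divide_self)
  also have "\<dots> \<le> ennreal s * Min ?W" using aspect False by (intro mult_right_mono) auto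
  finally show ?thesis using that[of "Min ?W"] min W by (auto intro: order.trans[OF Max_ge])
qed

text \<open>Bernoulli gives \<open>(1 + 1 / k) ^ k \<ge> 2\<close>, so \<open>k * s\<close> growth
  steps do the work of \<open>s\<close> doublings of the exponent.\<close>

lemma log_le_power_ratio:
  assumes "1 \<le> m" "m \<le> n" "1 \<le> k" and s: "1 \<le> s" "log 2 (log 2 (real n)) \<le> real s"
  shows "log 2 (real m) \<le> (1 + 1 / real k) ^ (k * s)"
proof -
  have "log 2 (real m) \<le> log 2 (real n)" using assms by simp
  also have "log 2 (real n) \<le> 2 ^ s"
  proof (cases "log 2 (real n) \<le> 2")
    case True
    have "(2 :: real) ^ 1 \<le> 2 ^ s" using s(1) by (intro power_increasing) auto
    then show ?thesis using True by simp
  next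
    case False
    then have "log 2 (real n) = 2 powr log 2 (log 2 (real n))" by simp
    also have "\<dots> \<le> 2 powr real s" using s(2) by (intro powr_mono) auto
    finally show ?thesis by (simp add: powr_realpow)
  qed
  also have "(2 :: real) ^ s \<le> ((1 + 1 / real k) ^ k) ^ s"
    using Bernoulli_inequality[of "1 / real k" k] assms(3)
    by (intro power_mono) (auto simp: field_simps)
  finally show ?thesis by (simp add: power_mult)
qed

theorem corollary2:
  fixes c :: real
  shows "\<exists>C>0. \<forall>(G :: 'a wgraph) (n :: nat) (h :: nat) (k :: nat) (r :: 'a).
    weighted_graph G \<and> finite_weights G \<and> card (verts G) = n \<and>
    (edges G \<noteq> {} \<longrightarrow> aspect_ratio G \<le> ennreal (real n powr c)) \<and>
    h \<ge> 1 \<and> k \<ge> 1 \<and> r \<in> verts G \<longrightarrow>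
    (\<exists>(T :: nat wgraph) (f :: 'a \<Rightarrow> nat set) (P :: nat \<Rightarrow> nat \<Rightarrow> 'a list).
       path_tree_embedding G T f P \<and>
       has_hop_bound T P (C * k_log_loglog k n * real h) \<and>
       real (card (\<Union> (f ` verts G))) \<le> (2 * real n) powr (1 + 1 / real k) \<and>
       card (f r) = 1 \<and>
       (\<forall>H. subgraph H G \<and> connected_graph H \<and> h_respecting h G H \<longrightarrow>
          (\<exists>H'. subgraph H' T \<and> connected_graph H' \<and>
             (\<forall>u\<in>verts H. verts H' \<inter> f u \<noteq> {}) \<and>
             total_weight H' \<le> ennreal (C * k_log_loglog k n) * total_weight H)))"
proof (intro exI[of _ "128 * (7 + \<bar>c\<bar>)"] conjI allI impI, goal_cases)
  case 1
  then show ?case by simp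
next
  case (2 G n h k r)
  then have G: "weighted_graph G" "finite_weights G" and n: "card (verts G) = n"
    and aspect: "edges G \<noteq> {} \<Longrightarrow> aspect_ratio G \<le> ennreal (real n powr c)"
    and k: "1 \<le> k" and r: "r \<in> verts G" by auto
  have fin: "finite (verts G)" using G(1) by (simp add: weighted_graph_def)
  have n1: "1 \<le> n" using n r fin by (metis One_nat_def Suc_leI card_gt_0_iff empty_iff)
  define lg where "lg = max 1 (log 2 (real n))"
  define llg where "llg = max 1 (log 2 (log 2 (real n)))"
  define s where "s = nat \<lceil>llg\<rceil>"
  \<comment> \<open>Exactly \<open>2 * j + 2\<close> for the last index
    \<open>j = 2 * (k * s) + 1\<close> that \<open>ring_growth\<close> may return.\<close>
  define L where "L = 4 * (k * s) + 4"
  \<comment> \<open>At most \<open>n ^ 2\<close> edges, each of weight at most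
    \<open>n powr c\<close> times \<open>a\<close>, make \<open>2 + \<bar>c\<bar>\<close> the
    exponent of the total weight. The offset 3 absorbs the factor 2, the strictness and the shift in
    \<open>width\<close>.\<close>
  define i where "i = nat \<lceil>(2 + \<bar>c\<bar>) * log 2 (real n)\<rceil> + 3"
  obtain a where a: "0 < a" "a < \<infinity>"
    "\<And>e. e \<in> edges G \<Longrightarrow> a \<le> weight G e \<and> weight G e \<le> ennreal (real n powr c) * a"
    using edge_weight_bounds[OF G aspect] by metis
  interpret ring_hierarchy G h L a
    by unfold_locales (use G a in \<open>auto simp: L_def\<close>)
  have s: "1 \<le> s" "log 2 (log 2 (real n)) \<le> real s" "real s \<le> 2 * llg"
    unfolding s_def llg_def by linarith+
  have logn: "0 \<le> log 2 (real n)" using n1 by simp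
  have i_le: "real (Suc i) \<le> (7 + \<bar>c\<bar>) * lg"
  proof -
    have "real (Suc i) \<le> (2 + \<bar>c\<bar>) * log 2 (real n) + 5"
      using logn unfolding i_def by (simp add: of_nat_nat) linarith
    also have "\<dots> \<le> (2 + \<bar>c\<bar>) * lg + 5 * lg"
      unfolding lg_def by (intro add_mono mult_left_mono) auto
    finally show ?thesis by (simp add: algebra_simps)
  qed
  have L_le: "real L \<le> 16 * real k * llg"
  proof -
    have "1 \<le> k * s" using k s(1) by simp
    then have "real L \<le> real (8 * (k * s))" unfolding L_def by (intro of_nat_mono) simp
    also have "\<dots> = 8 * real k * real s" by simp
    also have "\<dots> \<le> 8 * real k * (2 * llg)" using s(3) by (intro mult_left_mono) auto
    finally show ?thesis by simp
  qed
  \<comment> \<open>The constant is 8 times the 16 from \<open>L_le\<close> and the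
    \<open>7 + \<bar>c\<bar>\<close> from \<open>i_le\<close>.\<close>
  have iL: "8 * real L * real (Suc i) \<le> 128 * (7 + \<bar>c\<bar>) * k_log_loglog k n"
  proof -
    have "real L * real (Suc i) \<le> (16 * real k * llg) * ((7 + \<bar>c\<bar>) * lg)"
      using L_le i_le by (intro mult_mono) (auto simp: llg_def)
    then show ?thesis by (simp add: k_log_loglog_def lg_def llg_def algebra_simps)
  qed
  have ring: "\<exists>j. 2 * j + 2 \<le> L \<and>
      real (x (Suc j)) powr (1 + 1 / real k) + real (m - x j) powr (1 + 1 / real k) \<le>
      real m powr (1 + 1 / real k)"
    if x: "1 \<le> x 0" "\<And>j. x j \<le> m" "m \<le> card (verts G)" for x :: "nat \<Rightarrow> nat" and m
  proof -
    have "1 \<le> m" using x(1) x(2)[of 0] by simp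
    then have "log 2 (real m) \<le> (1 + 1 / real k) ^ (k * s)"
      using x(3) k s(1,2) n by (intro log_le_power_ratio) auto
    then obtain j where "j \<le> 2 * (k * s) + 1"
      "real (x (Suc j)) powr (1 + 1 / real k) + real (m - x j) powr (1 + 1 / real k) \<le>
       real m powr (1 + 1 / real k)"
      using ring_growth[of "1 / real k" x m "k * s"] x k by auto
    then show ?thesis by (intro exI[of _ j]) (auto simp: L_def)
  qed
  have "verts G \<noteq> {}" using r by auto
  from cluster_exists[OF ring order.refl this, of "Suc i" \<infinity> r]
  obtain t where t: "cluster (Suc i) (verts G) \<infinity> t"
    "real (length (leaves t)) \<le> real n powr (1 + 1 / real k)" "count_list (leaves t) r \<le> 1"
    using n by auto
  have leaves: "set (leaves t) = verts G" by (rule cluster_leaves[OF t(1)])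
  \<comment> \<open>The hypothesis of \<open>cluster_linked\<close> is trivial at the top, where
    \<open>d = \<infinity>\<close>.\<close>
  have linked: "linked G (wt t m) (2 * L * h) (leaves t ! m) (leaves t ! par t m)"
    if "0 < m" "m < length (leaves t)" for m
    using cluster_linked[OF t(1)] that by (simp add: linked_def)
  have wt: "0 < wt t m" if "0 < m" "m < length (leaves t)" for m
    using cluster_wt_pos[OF t(1)] that by simp
  let ?T = "embedding_tree t" and ?P = "tree_path G (2 * L * h) t"
  note emb = path_tree_embedding_ctree[OF leaves wt linked]
  have hop: "has_hop_bound ?T ?P (128 * (7 + \<bar>c\<bar>) * k_log_loglog k n * real h)"
  proof -
    have "has_hop_bound ?T ?P (real (2 * Suc i * (2 * L * h)))"
      using cluster_dep[OF t(1)] linked by (intro has_hop_bound_ctree) auto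
    moreover have "real (2 * Suc i * (2 * L * h)) \<le> 8 * real L * real (Suc i) * real h"
      by (simp add: algebra_simps)
    moreover have "8 * real L * real (Suc i) * real h \<le>
        128 * (7 + \<bar>c\<bar>) * k_log_loglog k n * real h"
      using iL by (intro mult_right_mono) auto
    ultimately show ?thesis unfolding has_hop_bound_def by (meson order.trans)
  qed
  have card: "real (card (\<Union> (copies t ` verts G))) \<le> (2 * real n) powr (1 + 1 / real k)"
  proof -
    have "real n powr (1 + 1 / real k) \<le> (2 * real n) powr (1 + 1 / real k)"
      by (intro powr_mono2) auto
    then show ?thesis using t(2) emb(2) by simp
  qed
  have "card (copies t r) = 1"
    using t(3) leaves r count_list_0_iff[of "leaves t" r] by (simp add: card_copies)
  moreover have "\<exists>H'. subgraph H' ?T \<and> connected_graph H' \<and>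
      (\<forall>u\<in>verts H. verts H' \<inter> copies t u \<noteq> {}) \<and>
      total_weight H' \<le> ennreal (128 * (7 + \<bar>c\<bar>) * k_log_loglog k n) * total_weight H"
    if H: "subgraph H G" "connected_graph H" "h_respecting h G H" for H
  proof -
    have HG: "edges H \<subseteq> edges G" "\<And>e. e \<in> edges H \<Longrightarrow> weight H e = weight G e"
      using H(1) by (auto simp: subgraph_def)
    have "total_weight H \<le> of_nat (card (edges H)) * (ennreal (real n powr c) * a)"
      unfolding total_weight_def using HG a(3) by (intro sum_bounded_above) auto
    also have "\<dots> \<le> of_nat (n ^ 2) * (ennreal (real n powr c) * a)"
      using card_mono[OF finite_edges[OF G(1)] HG(1)] card_edges_le[OF G(1)] n
      by (intro mult_right_mono of_nat_mono) auto
    also have "\<dots> = ennreal (real n ^ 2 * real n powr c) * a"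
      by (simp add: ennreal_of_nat_eq_real_of_nat ennreal_mult mult.assoc ennreal_power)
    finally have "2 * total_weight H \<le> 2 * (ennreal (real n ^ 2 * real n powr c) * a)"
      by (rule mult_left_mono) simp
    also have "\<dots> = ennreal (2 * (real n ^ 2 * real n powr c)) * a"
      by (simp add: ennreal_mult mult.assoc)
    also have "\<dots> < ennreal (2 ^ (i - 1)) * a"
    proof (rule ennreal_mult_strict_right_mono)
      have "real n ^ 2 * real n powr c \<le> real n ^ 2 * real n powr \<bar>c\<bar>"
        using n1 by (intro mult_left_mono powr_mono) auto
      also have "\<dots> = (2 powr log 2 (real n)) powr (2 + \<bar>c\<bar>)"
        using n1 by (simp add: powr_add powr_numeral)
      also have "\<dots> = 2 powr ((2 + \<bar>c\<bar>) * log 2 (real n))"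
        unfolding powr_powr by (simp add: mult.commute)
      also have "\<dots> \<le> 2 powr real (i - 3)"
        by (intro powr_mono) (auto simp: i_def real_nat_ceiling_ge)
      also have "\<dots> = 2 ^ (i - 3)" by (simp add: powr_realpow)
      finally have "2 * (real n ^ 2 * real n powr c) \<le> 2 ^ (i - 2)"
        using power_Suc[of "2 :: real" "i - 3"] by (simp add: i_def)
      also have "\<dots> < (2 :: real) ^ (i - 1)" by (intro power_strict_increasing) (auto simp: i_def)
      finally show "ennreal (2 * (real n ^ 2 * real n powr c)) < ennreal (2 ^ (i - 1))"
        by (simp add: ennreal_less_iff)
    qed (use a in auto)
    also have "\<dots> = width i" by (simp add: width_def ennreal_power[symmetric])
    finally have small: "2 * total_weight H < width i" .
    obtain H' where H': "subgraph H' ?T" "connected_graph H'"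
      "\<forall>u\<in>verts H. verts H' \<inter> copies t u \<noteq> {}"
      "total_weight H' \<le> of_nat (8 * L * Suc i) * total_weight H"
      using subgraph_of_embedding_tree[OF t(1) H small] by blast
    have "(of_nat (8 * L * Suc i) :: ennreal) \<le> ennreal (128 * (7 + \<bar>c\<bar>) * k_log_loglog k n)"
      unfolding ennreal_of_nat_eq_real_of_nat using iL
      by (intro ennreal_leI) (simp only: of_nat_mult of_nat_numeral)
    then have "total_weight H' \<le> ennreal (128 * (7 + \<bar>c\<bar>) * k_log_loglog k n) * total_weight H"
      using H'(4) by (meson mult_right_mono order.trans zero_le)
    then show ?thesis using H' by blast
  qed
  ultimately show ?case using emb(1) hop card by blast
qed

end
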